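(* Suppose that $p=p(n)\in[0,1]$ is such that $d = pn = n^{\xi + o(1)}$, where $\xi \in \left( \frac {1}{i+1}, \frac {1}{i} \right)$ for some $i \in \mathbb{N}$ ($i$ is an arbitrarily large but fixed constant). Then the following holds asymptotically almost surely for $G \in \mathcal{G}(n,p)$: $$ \mathrm{pq}(G) = \Theta \big( \mathrm{eq}(G) \big) = \Theta \left( \frac {n \log n}{d^i} \right). $$
   Context: Query game on a simple graph $G=(V,E)$: $d_G(u,v)$ denotes the graph distance. An adversary fixes a target vertex $v^*\in V$ unknown to an adaptive algorithm. In each round the algorithm queries two vertices $u,v$, and the adversary replies with whichever of $u,v$ is closer to $v^*$ (with either one, at the adversary's choice, if $d_G(u,v^* )=d_G(v,v^* )$). Equivalently: put $V_0=V$; in round $t$ the algorithm presents $(u_t,v_t)$ (depending on $G$ and earlier replies) and the adversary chooses either $V_t=\{x\in V_{t-1}: d_G(u_t,x)\le d_G(v_t,x)\}$ (reply $u_t$) or $V_t=\{x\in V_{t-1}: d_G(v_t,x)\le d_G(u_t,x)\}$ (reply $v_t$); the target is located once $|V_t|=1$. A pair query allows arbitrary $u,v\in V$; an edge query requires $u$ and $v$ to be adjacent. $\mathrm{pq}(G)$ (respectively $\mathrm{eq}(G)$) is the least integer $t$ such that the algorithm can locate the target in at most $t$ pair queries (respectively edge queries), regardless of the strategy of the adversary. $\mathcal{G}(n,p)$ is the binomial random graph on vertex set $\{1,\dots,n\}$, each pair being an edge independently with probability $p=p(n)$. A property holds asymptotically almost surely (a.a.s.) if its probability tends to $1$ as $n\to\infty$.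 $\log$ is the natural logarithm, $\mathbb{N}=\{1,2,\dots\}$, and asymptotic notation is as $n\to\infty$. *)

theory Defs
  imports "HOL-Probability.Probability" "HOL-Probability.Product_PMF"
begin

text \<open>
  A simple graph is given by a vertex set \<open>V\<close> and its adjacency relation
  \<open>E \<subseteq> V \<times> V\<close>, which is symmetric and irreflexive.
\<close>

text \<open>\<open>(u, v) \<in> E ^^ k\<close> means that there is a walk of length \<open>k\<close> from \<open>u\<close> to \<open>v\<close>; the distance
  between vertices in different components is \<open>\<infinity>\<close>.\<close>

definition graph_dist :: "'a rel \<Rightarrow> 'a \<Rightarrow> 'a \<Rightarrow> enat" where
  "graph_dist E u v = (INF k \<in> {k. (u, v) \<in> E ^^ k}. enat k)"

text \<open>
  An adaptive algorithm maps the history of replies (most recent one first) to the next query.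
  A reply \<open>True\<close> to the query \<open>(u, v)\<close> names \<open>u\<close>, a reply \<open>False\<close> names \<open>v\<close>.
\<close>

type_synonym 'a strategy = "bool list \<Rightarrow> 'a \<times> 'a"

fun candidates :: "'a set \<Rightarrow> 'a rel \<Rightarrow> 'a strategy \<Rightarrow> bool list \<Rightarrow> 'a set" where
  "candidates V E \<sigma> [] = V"
| "candidates V E \<sigma> (b # h) =
     (case \<sigma> h of (u, v) \<Rightarrow>
        if b then {x \<in> candidates V E \<sigma> h. graph_dist E u x \<le> graph_dist E v x}
        else {x \<in> candidates V E \<sigma> h. graph_dist E v x \<le> graph_dist E u x})"

text \<open>
  The replies in \<open>h\<close> are truthful for a target \<open>x\<close> iff \<open>x \<in> candidates V E \<sigma> h\<close>, so the histories
  that the adversary can produce are exactly those with a nonempty set of candidates.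
  Truthful replies never change a singleton set of candidates; hence it is enough to
  look at histories of length exactly \<open>t\<close>, and the queries made after the target has been located
  need not be legal.
\<close>

definition locates_within ::
    "'a set \<Rightarrow> 'a rel \<Rightarrow> ('a \<times> 'a) set \<Rightarrow> nat \<Rightarrow> 'a strategy \<Rightarrow> bool" where
  "locates_within V E Q t \<sigma> \<longleftrightarrow>
     (\<forall>h. length h < t \<and> candidates V E \<sigma> h \<noteq> {} \<and> card (candidates V E \<sigma> h) \<noteq> 1 \<longrightarrow> \<sigma> h \<in> Q) \<and>
     (\<forall>h. length h = t \<and> candidates V E \<sigma> h \<noteq> {} \<longrightarrow> card (candidates V E \<sigma> h) = 1)"

text \<open>The value is \<open>\<infinity>\<close> if no number of legal queries suffices, as may happen for edge
  queries in a disconnected graph.\<close>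

definition query_number :: "'a set \<Rightarrow> 'a rel \<Rightarrow> ('a \<times> 'a) set \<Rightarrow> enat" where
  "query_number V E Q = (INF t \<in> {t. \<exists>\<sigma>. locates_within V E Q t \<sigma>}. enat t)"

definition pq :: "'a set \<Rightarrow> 'a rel \<Rightarrow> enat" where
  "pq V E = query_number V E (V \<times> V)"

definition eq :: "'a set \<Rightarrow> 'a rel \<Rightarrow> enat" where
  "eq V E = query_number V E E"

definition gnp :: "nat \<Rightarrow> real \<Rightarrow> nat rel pmf" where
  "gnp n p = map_pmf (\<lambda>f. {(u, v). f (u, v) \<or> f (v, u)})
     (Pi_pmf {(u, v). 1 \<le> u \<and> u < v \<and> v \<le> n} False (\<lambda>_. bernoulli_pmf p))"

definition aas :: "(nat \<Rightarrow> 'a pmf) \<Rightarrow> (nat \<Rightarrow> 'a \<Rightarrow> bool) \<Rightarrow> bool" where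
  "aas M P \<longleftrightarrow> (\<lambda>n. measure_pmf.prob (M n) {x. P n x}) \<longlonglongrightarrow> 1"

text \<open>\<open>X = \<Theta>(Y)\<close> asymptotically almost surely: the two constants do not depend on \<open>n\<close> or on the
  random outcome.\<close>

definition aas_bigtheta ::
    "(nat \<Rightarrow> 'a pmf) \<Rightarrow> (nat \<Rightarrow> 'a \<Rightarrow> ereal) \<Rightarrow> (nat \<Rightarrow> 'a \<Rightarrow> ereal) \<Rightarrow> bool" where
  "aas_bigtheta M X Y \<longleftrightarrow>
     (\<exists>c C :: real. 0 < c \<and> 0 < C \<and>
        aas M (\<lambda>n x. ereal c * Y n x \<le> X n x \<and> X n x \<le> ereal C * Y n x))"

end

theory Submission imports Defs "HOL-Real_Asymp.Real_Asymp" begin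

text \<open>
  Put \<open>\<beta> = d\<^sup>i\<^sup>+\<^sup>1 / n\<close>, a positive power of \<open>n\<close>, while \<open>d\<^sup>i / n\<close> is a negative power. The edges at a
  vertex \<open>x\<close> are independent of the balls in \<open>G - x\<close>, so Chernoff's bound and a union bound show
  that a typical \<open>G\<close> has diameter at most \<open>i + 1\<close> and that every \<open>x\<close> has only \<open>O(\<beta>)\<close> neighbours
  within distance \<open>j \<le> i\<close> of a vertex \<open>y\<close> at distance at least \<open>j\<close> from \<open>x\<close>. Counting walks by
  their level with respect to \<open>y\<close>, two spheres of radius \<open>i\<close> therefore meet in \<open>O(d\<^sup>2\<^sup>i / n)\<close> vertices.

  Upper bound. Let \<open>X\<close> be a set of at least \<open>n / d\<^sup>i\<close> candidates. By the second moment method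
  linearly many vertices have \<open>\<Omega>(|X| d\<^sup>i / n)\<close> elements of \<open>X\<close> at distance exactly \<open>i\<close>. There are many
  edges between such vertices, and all but few of these edges have the property that either reply
  excludes a fraction \<open>\<Omega>(d\<^sup>i / n)\<close> of \<open>X\<close>. Hence \<open>O(n log n / d\<^sup>i)\<close> edge queries leave \<open>O(n / d\<^sup>i)\<close>
  candidates, and then an edge of a geodesic between two candidates excludes at least one of them.

  Lower bound. The adversary always names the first vertex, so a query only excludes vertices of a
  ball of radius \<open>i\<close>. If \<open>k\<close> such balls cover \<open>G\<close>, then the corresponding balls of radius \<open>i - 1\<close> form
  a dominating set of size \<open>O(k d\<^sup>i\<^sup>-\<^sup>1)\<close>, but a typical \<open>G\<close> has no dominating set of size
  \<open>c n log n / d\<close>.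
\<close>

section \<open>Graph distance\<close>

lemma graph_dist_le_iff: "graph_dist E x y \<le> enat j \<longleftrightarrow> (\<exists>k\<le>j. (x, y) \<in> E ^^ k)"
proof
  show "\<exists>k\<le>j. (x, y) \<in> E ^^ k" if "graph_dist E x y \<le> enat j"
  proof (rule ccontr)
    assume "\<not> ?thesis"
    then have "enat (Suc j) \<le> graph_dist E x y"
      unfolding graph_dist_def by (intro INF_greatest) (auto simp: not_le Suc_le_eq)
    then have "enat (Suc j) \<le> enat j" using that by (rule order.trans)
    then show False by simp
  qed
  show "graph_dist E x y \<le> enat j" if "\<exists>k\<le>j. (x, y) \<in> E ^^ k"
    using that unfolding graph_dist_def by (auto intro: INF_lower2)
qed

text \<open>Peeling off the first step of a walk gives the recursion on the radius that drives the
  inductions on balls. The case \<open>x = y\<close> stands apart because \<open>x\<close> may be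
  isolated.\<close>

lemma graph_dist_le_Suc_iff:
  "graph_dist E x y \<le> enat (Suc j) \<longleftrightarrow> x = y \<or> (\<exists>w. (x, w) \<in> E \<and> graph_dist E w y \<le> enat j)"
proof
  assume "graph_dist E x y \<le> enat (Suc j)"
  then obtain k where k: "k \<le> Suc j" "(x, y) \<in> E ^^ k"
    by (auto simp: graph_dist_le_iff)
  show "x = y \<or> (\<exists>w. (x, w) \<in> E \<and> graph_dist E w y \<le> enat j)"
  proof (cases k)
    case (Suc l)
    with k obtain w where "(x, w) \<in> E" "(w, y) \<in> E ^^ l" by (blast dest: relpow_Suc_D2)
    with k Suc show ?thesis by (auto simp: graph_dist_le_iff)
  qed (use k in auto)
next
  assume "x = y \<or> (\<exists>w. (x, w) \<in> E \<and> graph_dist E w y \<le> enat j)"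
  then show "graph_dist E x y \<le> enat (Suc j)"
  proof
    assume "\<exists>w. (x, w) \<in> E \<and> graph_dist E w y \<le> enat j"
    then obtain w k where "(x, w) \<in> E" "k \<le> j" "(w, y) \<in> E ^^ k"
      by (auto simp: graph_dist_le_iff)
    then have "(x, y) \<in> E ^^ Suc k" "Suc k \<le> Suc j" by (blast intro: relpow_Suc_I2, simp)
    then show ?thesis unfolding graph_dist_le_iff by blast
  qed (auto simp: graph_dist_le_iff intro!: exI[of _ 0])
qed

lemma graph_dist_le_0_iff: "graph_dist E x y \<le> enat 0 \<longleftrightarrow> x = y"
  by (simp add: graph_dist_le_iff)

lemma graph_dist_eq_0_iff: "graph_dist E x y = enat 0 \<longleftrightarrow> x = y"
  using graph_dist_le_0_iff[of E x y] by (simp add: zero_enat_def[symmetric])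

lemma graph_dist_mono:
  assumes "E' \<subseteq> E"
  shows "graph_dist E x y \<le> graph_dist E' x y"
proof (cases "graph_dist E' x y")
  case (enat j)
  have mono: "E' ^^ k \<subseteq> E ^^ k" for k
    by (induction k) (use assms in auto)
  from enat obtain k where "k \<le> j" "(x, y) \<in> E' ^^ k"
    using graph_dist_le_iff[of E' x y j] by auto
  moreover from this mono have "(x, y) \<in> E ^^ k" by blast
  ultimately show ?thesis using enat by (auto simp: graph_dist_le_iff)
qed simp

lemma enat_le_Suc_iff: "(e::enat) \<le> enat (Suc j) \<longleftrightarrow> e \<le> enat j \<or> e = enat (Suc j)"
  by (cases e) auto

lemma not_less_enat_Suc: "\<not> (e::enat) < enat (Suc j) \<longleftrightarrow> \<not> e \<le> enat j"
  by (cases e) auto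

text \<open>Deletion only isolates \<open>x\<close>; the vertex set stays, so distances before and
  after are compared on the same vertices.\<close>

definition del_vertex :: "'a \<Rightarrow> 'a rel \<Rightarrow> 'a rel" where
  "del_vertex x E = {(a, b) \<in> E. a \<noteq> x \<and> b \<noteq> x}"

section \<open>Balls and geodesics in finite simple graphs\<close>

locale fin_graph =
  fixes V :: "'a set" and E :: "'a rel"
  assumes finV: "finite V" and EV: "E \<subseteq> V \<times> V" and symE: "sym E" and irrE: "irrefl E"
begin

abbreviation D :: "'a \<Rightarrow> 'a \<Rightarrow> enat" where "D \<equiv> graph_dist E"

lemma E_sym: "(x, y) \<in> E \<longleftrightarrow> (y, x) \<in> E"
  using symE by (auto dest: symD)

lemma E_V: "(x, y) \<in> E \<Longrightarrow> x \<in> V \<and> y \<in> V"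
  using EV by auto

lemma finite_nbr [simp]: "finite {w. (x, w) \<in> E}"
  by (rule finite_subset[OF _ finV]) (use EV in auto)

lemma relpow_sym: "(x, y) \<in> E ^^ k \<Longrightarrow> (y, x) \<in> E ^^ k"
proof (induction k arbitrary: y)
  case (Suc k)
  then obtain z where "(x, z) \<in> E ^^ k" "(z, y) \<in> E" by auto
  with Suc.IH have "(z, x) \<in> E ^^ k" "(y, z) \<in> E" using E_sym by auto
  then show ?case by (rule relpow_Suc_I2[rotated])
qed auto

lemma D_sym: "D x y = D y x"
proof -
  have "(x, y) \<in> E ^^ k \<longleftrightarrow> (y, x) \<in> E ^^ k" for k using relpow_sym by blast
  then show ?thesis by (simp add: graph_dist_def)
qed

lemma D_edge: "(u, v) \<in> E \<Longrightarrow> D u x \<le> enat j \<Longrightarrow> D v x \<le> enat (Suc j)"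
  using E_sym by (auto simp: graph_dist_le_Suc_iff)

lemma D_le_in_V: "D x y \<le> enat j \<Longrightarrow> x \<in> V \<Longrightarrow> y \<in> V"
  by (induction j arbitrary: x) (use E_V in \<open>auto simp: graph_dist_le_0_iff graph_dist_le_Suc_iff\<close>)

lemma finite_ball [simp]: "x \<in> V \<Longrightarrow> finite {y. D x y \<le> enat j}"
  by (rule finite_subset[OF _ finV]) (auto intro: D_le_in_V)

lemma finite_ball' [simp]: "x \<in> V \<Longrightarrow> finite {y. D y x \<le> enat j}"
  using finite_ball[of x j] by (simp add: D_sym)

text \<open>A path from \<open>w\<close> to \<open>y\<close> through \<open>x\<close> is too long, so a geodesic avoids \<open>x\<close>.\<close>

lemma D_del_vertex:
  assumes "\<not> D x y < enat j" "w \<noteq> x" "D w y \<le> enat j"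
  shows "graph_dist (del_vertex x E) w y \<le> enat j"
  using assms
proof (induction j arbitrary: w)
  case 0
  then show ?case by (simp add: graph_dist_le_0_iff)
next
  case (Suc j)
  have far: "\<not> D x y \<le> enat j" using Suc.prems(1) by (simp add: not_less_enat_Suc)
  show ?case
  proof (cases "w = y")
    case False
    then obtain z where z: "(w, z) \<in> E" "D z y \<le> enat j"
      using Suc.prems(3) by (auto simp: graph_dist_le_Suc_iff)
    have "z \<noteq> x" using z far by auto
    moreover have "\<not> D x y < enat j" using far by (meson less_imp_le)
    ultimately have "graph_dist (del_vertex x E) z y \<le> enat j" using Suc.IH z by blast
    moreover have "(w, z) \<in> del_vertex x E"
      using z Suc.prems \<open>z \<noteq> x\<close> by (auto simp: del_vertex_def)
    ultimately show ?thesis by (auto simp: graph_dist_le_Suc_iff)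
  qed (auto simp: graph_dist_le_Suc_iff)
qed

text \<open>The larger ball is the centre together with the balls around its neighbours. The
  \<open>- 1\<close> makes the induction close: with \<open>2 \<le> \<Delta>\<close> it absorbs the
  centre.\<close>

lemma card_ball:
  fixes \<Delta> :: real
  assumes deg: "\<And>x. x \<in> V \<Longrightarrow> real (card {w. (x, w) \<in> E}) \<le> \<Delta>" and "2 \<le> \<Delta>" and "x \<in> V"
  shows "real (card {y. D x y \<le> enat j}) \<le> 2 * \<Delta> ^ j - 1"
  using \<open>x \<in> V\<close>
proof (induction j arbitrary: x)
  case 0
  then show ?case by (simp add: graph_dist_le_0_iff)
next
  case (Suc j)
  let ?N = "{w. (x, w) \<in> E}"
  have NV: "?N \<subseteq> V" using E_V by auto
  have "{y. D x y \<le> enat (Suc j)} = {x} \<union> (\<Union>w\<in>?N. {y. D w y \<le> enat j})"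
    by (auto simp: graph_dist_le_Suc_iff)
  then have "card {y. D x y \<le> enat (Suc j)} \<le> 1 + card (\<Union>w\<in>?N. {y. D w y \<le> enat j})"
    using card_Un_le[of "{x}" "\<Union>w\<in>?N. {y. D w y \<le> enat j}"] by simp
  also have "\<dots> \<le> 1 + (\<Sum>w\<in>?N. card {y. D w y \<le> enat j})"
    using card_UN_le[OF finite_nbr[of x], of "\<lambda>w. {y. D w y \<le> enat j}"] by simp
  finally have "real (card {y. D x y \<le> enat (Suc j)})
      \<le> real (1 + (\<Sum>w\<in>?N. card {y. D w y \<le> enat j}))"
    by (simp only: of_nat_le_iff)
  also have "\<dots> = 1 + (\<Sum>w\<in>?N. real (card {y. D w y \<le> enat j}))"
    by simp
  also have "\<dots> \<le> 1 + (\<Sum>w\<in>?N. 2 * \<Delta> ^ j - 1)"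
    using Suc.IH NV by (intro add_left_mono sum_mono) auto
  also have "\<dots> \<le> 1 + \<Delta> * (2 * \<Delta> ^ j - 1)"
  proof -
    have "1 \<le> \<Delta> ^ j" using \<open>2 \<le> \<Delta>\<close> by (intro one_le_power) auto
    then show ?thesis using deg[OF Suc.prems] by (auto intro!: mult_right_mono)
  qed
  also have "\<dots> \<le> 2 * \<Delta> ^ Suc j - 1"
    using \<open>2 \<le> \<Delta>\<close> by (simp add: algebra_simps)
  finally show ?case .
qed

lemma card_ball_le:
  fixes d :: real
  assumes deg: "\<And>x. x \<in> V \<Longrightarrow> real (card {w. (x, w) \<in> E}) \<le> 4 * d" and "1 \<le> d" "x \<in> V" "j \<le> i"
  shows "real (card {y. D x y \<le> enat j}) \<le> 2 * 4 ^ i * d ^ j"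
proof -
  have "real (card {y. D x y \<le> enat j}) \<le> 2 * (4 * d) ^ j - 1"
    using assms by (intro card_ball) auto
  also have "\<dots> \<le> 2 * 4 ^ j * d ^ j" by (simp add: power_mult_distrib)
  also have "\<dots> \<le> 2 * 4 ^ i * d ^ j"
    using assms by (intro mult_right_mono mult_left_mono power_increasing) auto
  finally show ?thesis .
qed

text \<open>Every edge of a geodesic from \<open>x\<close> to \<open>y\<close> separates \<open>x\<close> from \<open>y\<close> whatever the reply.\<close>

lemma separating_edge:
  assumes "x \<noteq> y" "D x y \<noteq> \<infinity>"
  obtains v where "(x, v) \<in> E" "D x x < D v x" "D v y < D x y"
proof -
  obtain j where j: "D x y = enat j" using assms(2) by auto
  with assms(1) obtain k where k: "j = Suc k"
    by (cases j) (auto simp: graph_dist_eq_0_iff)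
  from j k obtain v where v: "(x, v) \<in> E" "D v y \<le> enat k"
    using graph_dist_le_Suc_iff[of E x y k] assms(1) by auto
  have "v \<noteq> x" using v(1) irrE by (auto simp: irrefl_def)
  then have "D v x \<noteq> 0" using graph_dist_eq_0_iff[of E v x] by (simp add: zero_enat_def)
  moreover have "D x x = 0" using graph_dist_eq_0_iff[of E x x] by (simp add: zero_enat_def)
  ultimately have "D x x < D v x" by (simp add: zero_less_iff_neq_zero)
  moreover have "D v y < D x y" using v(2) j k by (metis enat_ord_simps(2) lessI order_le_less_trans)
  ultimately show ?thesis using that v(1) by blast
qed

end


section \<open>Codegrees and separating edges\<close>

text \<open>The constants of the recursion in \<open>codegree_aux\<close>: the factor 4 stems from
  the degree bound \<open>4 * d\<close>, the summand \<open>M\<close> from the bound on a whole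
  ball.\<close>

primrec codeg_const :: "real \<Rightarrow> nat \<Rightarrow> real" where
  "codeg_const M 0 = 1"
| "codeg_const M (Suc a) = 4 * codeg_const M a + M"

lemma codeg_const_nonneg: "0 \<le> M \<Longrightarrow> 0 \<le> codeg_const M a"
  by (induction a) auto

text \<open>The deterministic properties of a typical graph. For \<open>j = D x y\<close> the two
  back-edge conditions bound the edges at \<open>x\<close> that do not lead away from
  \<open>y\<close>. Below radius \<open>i\<close> this number is a constant \<open>K\<close>; at
  radius \<open>i\<close> it may be as large as \<open>B\<close>. With \<open>deg_lo\<close>, the
  condition \<open>16 * B \<le> d\<close> leaves at least \<open>d / 16\<close> edges leading
  away.\<close>

locale spread_graph = fin_graph V E for V :: "'a set" and E +
  fixes i :: nat and d B K M :: real
  assumes i1: "1 \<le> i" and d1: "1 \<le> d" and K1: "1 \<le> K" and Bd: "16 * B \<le> d" and B0: "0 \<le> B"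
    and M_def: "M = 2 * 4 ^ i"
    and deg_lo: "\<And>x. x \<in> V \<Longrightarrow> d / 8 \<le> real (card {w. (x, w) \<in> E})"
    and deg_hi: "\<And>x. x \<in> V \<Longrightarrow> real (card {w. (x, w) \<in> E}) \<le> 4 * d"
    and few_back: "\<And>x y j. x \<in> V \<Longrightarrow> y \<in> V \<Longrightarrow> j \<le> i \<Longrightarrow> \<not> D x y < enat j \<Longrightarrow>
      real (card {w. (x, w) \<in> E \<and> D w y \<le> enat j}) \<le> B"
    and few_back': "\<And>x y j. x \<in> V \<Longrightarrow> y \<in> V \<Longrightarrow> j < i \<Longrightarrow> \<not> D x y < enat j \<Longrightarrow>
      real (card {w. (x, w) \<in> E \<and> D w y \<le> enat j}) \<le> K"
begin

lemma M0: "0 \<le> M" by (simp add: M_def)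

lemma ball_le:
  assumes "x \<in> V" "j \<le> i"
  shows "real (card {y. D x y \<le> enat j}) \<le> M * d ^ j"
  unfolding M_def using deg_hi d1 assms by (rule card_ball_le)

text \<open>Double counting of the edges between consecutive spheres: each inner vertex sends at
  least \<open>d / 8 - B \<ge> d / 16\<close> edges outwards, and each outer vertex receives at most
  \<open>K\<close> of them.\<close>

lemma sphere_ge:
  assumes "x \<in> V" "j \<le> i"
  shows "(d / (16 * K)) ^ j \<le> real (card {y. D y x = enat j})"
  using assms(2)
proof (induction j)
  case 0
  then show ?case by (simp add: graph_dist_eq_0_iff)
next
  case (Suc j)
  let ?S = "\<lambda>j. {y. D y x = enat j}"
  have fin: "finite (?S j)" for j
    by (rule finite_subset[OF _ finite_ball'[OF assms(1), of j]]) auto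
  have SV: "y \<in> V" if "y \<in> ?S j" for y j
    using that D_le_in_V[of x y j] D_sym[of x y] assms(1) by simp
  have "real (card (?S j)) * (d / 16) \<le> (\<Sum>u\<in>?S j. real (card {w \<in> ?S (Suc j). (u, w) \<in> E}))"
  proof -
    have "d / 16 \<le> real (card {w \<in> ?S (Suc j). (u, w) \<in> E})" if u: "u \<in> ?S j" for u
    proof -
      have "D u x \<le> enat j" using u by simp
      then have "{w. (u, w) \<in> E} \<subseteq>
          {w. (u, w) \<in> E \<and> D w x \<le> enat j} \<union> {w \<in> ?S (Suc j). (u, w) \<in> E}"
        using D_edge[of u _ x j] by (auto simp: enat_le_Suc_iff)
      then have "card {w. (u, w) \<in> E} \<le>
          card ({w. (u, w) \<in> E \<and> D w x \<le> enat j} \<union> {w \<in> ?S (Suc j). (u, w) \<in> E})"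
        by (intro card_mono) (auto intro: finite_subset[OF _ finite_nbr[of u]])
      also have "\<dots> \<le> card {w. (u, w) \<in> E \<and> D w x \<le> enat j} + card {w \<in> ?S (Suc j). (u, w) \<in> E}"
        by (rule card_Un_le)
      finally have "real (card {w. (u, w) \<in> E}) \<le>
          real (card {w. (u, w) \<in> E \<and> D w x \<le> enat j}) + real (card {w \<in> ?S (Suc j). (u, w) \<in> E})"
        by linarith
      moreover have "real (card {w. (u, w) \<in> E \<and> D w x \<le> enat j}) \<le> B"
        using few_back[OF SV[OF u] assms(1), of j] u Suc.prems by simp
      ultimately show ?thesis using deg_lo[OF SV[OF u]] Bd by linarith
    qed
    then have "(\<Sum>u\<in>?S j. d / 16) \<le> (\<Sum>u\<in>?S j. real (card {w \<in> ?S (Suc j). (u, w) \<in> E}))"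
      by (intro sum_mono) auto
    then show ?thesis by simp
  qed
  also have "\<dots> = (\<Sum>w\<in>?S (Suc j). real (card {u \<in> ?S j. (u, w) \<in> E}))"
    unfolding real_of_card by (rule sum.swap_restrict[OF fin fin])
  also have "\<dots> \<le> (\<Sum>w\<in>?S (Suc j). K)"
  proof (rule sum_mono)
    fix w assume w: "w \<in> ?S (Suc j)"
    have "card {u \<in> ?S j. (u, w) \<in> E} \<le> card {u. (w, u) \<in> E \<and> D u x \<le> enat j}"
      using E_sym by (intro card_mono) (auto intro: finite_subset[OF _ finite_nbr[of w]])
    also have "real \<dots> \<le> K"
      using few_back'[OF SV[OF w] assms(1), of j] w Suc.prems by simp
    finally show "real (card {u \<in> ?S j. (u, w) \<in> E}) \<le> K" by simp
  qed
  finally have *: "real (card (?S j)) * (d / 16) \<le> real (card (?S (Suc j))) * K" by simp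
  have "(d / (16 * K)) ^ Suc j \<le> real (card (?S j)) * (d / (16 * K))"
    unfolding power_Suc2 using Suc d1 K1 by (intro mult_right_mono) auto
  also have "\<dots> \<le> real (card (?S (Suc j)))"
    using * K1 by (simp add: field_simps)
  finally show ?case .
qed

text \<open>Along a geodesic from \<open>x\<close> to \<open>u\<close> the lower bound
  \<open>i - a\<close> on the distance from \<open>y\<close> should grow by one with each step. It
  cannot do so for all \<open>a + 1\<close> steps, because \<open>u\<close> is only at distance
  \<open>i\<close> from \<open>y\<close>. The first step that fails has at most \<open>B\<close>
  choices instead of \<open>4 * d\<close>; after it the ball bound suffices.\<close>

lemma codegree_aux:
  assumes "x \<in> V" "y \<in> V" "a < i" "\<not> D x y < enat (i - a)"
  shows "real (card {u. D x u = enat (Suc a) \<and> D u y = enat i}) \<le> codeg_const M a * d ^ a * B"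
  using assms(1,3,4)
proof (induction a arbitrary: x)
  case 0
  have "{u. D x u = enat (Suc 0) \<and> D u y = enat i} \<subseteq> {w. (x, w) \<in> E \<and> D w y \<le> enat i}"
  proof safe
    fix u assume "D x u = enat (Suc 0)"
    then have "D x u \<le> enat (Suc 0)" "\<not> D x u \<le> enat 0" by simp_all
    then show "(x, u) \<in> E" by (auto simp: graph_dist_le_Suc_iff graph_dist_le_0_iff)
  qed auto
  then have "card {u. D x u = enat (Suc 0) \<and> D u y = enat i} \<le> card {w. (x, w) \<in> E \<and> D w y \<le> enat i}"
    by (intro card_mono) (auto intro: finite_subset[OF _ finite_nbr[of x]])
  also have "real \<dots> \<le> B" using few_back[of x y i] 0 assms by auto
  finally show ?case by simp
next
  case (Suc a)
  let ?F = "\<lambda>a x. {u. D x u = enat (Suc a) \<and> D u y = enat i}"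
  let ?N = "{w. (x, w) \<in> E}"
  \<comment> \<open>\<open>?N1\<close> collects the few neighbours that violate the distance
    hypothesis for \<open>a\<close>; the induction hypothesis applies to the others.\<close>
  let ?N1 = "{w. (x, w) \<in> E \<and> D w y \<le> enat (i - Suc a)}"
  let ?N2 = "?N - ?N1"
  have NV: "w \<in> V" if "w \<in> ?N" for w using that E_V by auto
  have finF: "finite (?F a w)" if "w \<in> V" for a w
    by (rule finite_subset[OF _ finite_ball[OF that, of "Suc a"]]) auto
  have "?F (Suc a) x \<subseteq> (\<Union>w\<in>?N. ?F a w)"
  proof
    fix u assume u: "u \<in> ?F (Suc a) x"
    then have *: "D x u \<le> enat (Suc (Suc a))" "\<not> D x u \<le> enat (Suc a)" by simp_all
    then obtain w where w: "(x, w) \<in> E" "D w u \<le> enat (Suc a)"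
      by (subst (asm) graph_dist_le_Suc_iff) (auto simp: graph_dist_le_Suc_iff)
    moreover have "\<not> D w u \<le> enat a"
      using * w(1) graph_dist_le_Suc_iff by metis
    ultimately have "D w u = enat (Suc a)" by (simp add: enat_le_Suc_iff)
    with w u show "u \<in> (\<Union>w\<in>?N. ?F a w)" by auto
  qed
  then have "card (?F (Suc a) x) \<le> card (\<Union>w\<in>?N. ?F a w)"
    using finF NV by (intro card_mono) auto
  also have "\<dots> \<le> (\<Sum>w\<in>?N. card (?F a w))" by (rule card_UN_le) simp
  finally have "real (card (?F (Suc a) x)) \<le> real (\<Sum>w\<in>?N. card (?F a w))"
    by (simp only: of_nat_le_iff)
  also have "\<dots> = (\<Sum>w\<in>?N. real (card (?F a w)))" by simp
  also have "\<dots> = (\<Sum>w\<in>?N2. real (card (?F a w))) + (\<Sum>w\<in>?N1. real (card (?F a w)))"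
    by (rule sum.subset_diff) auto
  also have "\<dots> \<le> real (card ?N2) * (codeg_const M a * d ^ a * B) + real (card ?N1) * (M * d ^ Suc a)"
  proof (intro add_mono)
    show "(\<Sum>w\<in>?N2. real (card (?F a w))) \<le> real (card ?N2) * (codeg_const M a * d ^ a * B)"
    proof (rule sum_bounded_above)
      fix w assume w: "w \<in> ?N2"
      have "enat (i - Suc a) < D w y" using w by auto
      moreover have "i - a = Suc (i - Suc a)" using Suc.prems by simp
      ultimately have "\<not> D w y < enat (i - a)" by (simp add: not_less_enat_Suc)
      then show "real (card (?F a w)) \<le> codeg_const M a * d ^ a * B"
        using w NV Suc.prems by (intro Suc.IH) auto
    qed
    show "(\<Sum>w\<in>?N1. real (card (?F a w))) \<le> real (card ?N1) * (M * d ^ Suc a)"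
    proof (rule sum_bounded_above)
      fix w assume w: "w \<in> ?N1"
      then have "w \<in> V" using NV by auto
      then have "card (?F a w) \<le> card {u. D w u \<le> enat (Suc a)}"
        by (intro card_mono) auto
      also have "real \<dots> \<le> M * d ^ Suc a"
        using \<open>w \<in> V\<close> Suc.prems by (intro ball_le) auto
      finally show "real (card (?F a w)) \<le> M * d ^ Suc a" by simp
    qed
  qed
  also have "\<dots> \<le> (4 * d) * (codeg_const M a * d ^ a * B) + B * (M * d ^ Suc a)"
  proof (intro add_mono mult_right_mono)
    have "card ?N2 \<le> card ?N" by (intro card_mono) auto
    then show "real (card ?N2) \<le> 4 * d" using deg_hi[OF Suc.prems(1)] by linarith
    show "real (card ?N1) \<le> B"
      using few_back[of x y "i - Suc a"] Suc.prems assms by auto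
  qed (use codeg_const_nonneg[OF M0] M0 B0 d1 in auto)
  also have "\<dots> = codeg_const M (Suc a) * d ^ Suc a * B"
    by (simp add: algebra_simps)
  finally show ?case .
qed

text \<open>For \<open>a = i - 1\<close> the distance hypothesis of \<open>codegree_aux\<close>
  reads \<open>x \<noteq> y\<close>. With \<open>B\<close> of order \<open>d ^ (i + 1) / n\<close>
  the bound is of order \<open>d ^ (2 * i) / n\<close>, as for two independent random sets of size
  \<open>d ^ i\<close>.\<close>

lemma codegree:
  assumes "x \<in> V" "y \<in> V" "x \<noteq> y"
  shows "real (card {u. D u x = enat i \<and> D u y = enat i}) \<le> codeg_const M (i - 1) * d ^ (i - 1) * B"
proof -
  obtain a where a: "i = Suc a" using i1 by (cases i) auto
  have "\<not> D x y < enat (Suc 0)"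
    unfolding not_less_enat_Suc graph_dist_le_0_iff by (rule assms(3))
  then have "real (card {u. D x u = enat i \<and> D u y = enat i}) \<le> codeg_const M a * d ^ a * B"
    using codegree_aux[OF assms(1,2), of a] a by simp
  moreover have "D u x = D x u" for u by (rule D_sym)
  ultimately show ?thesis by (simp only: a diff_Suc_1)
qed

section \<open>Second moment method and separating edges\<close>

definition lam :: real where "lam = (1 / (16 * K)) ^ i"
definition alpha :: real where "alpha = lam ^ 2 / (4 * M * (1 + 4 * codeg_const M (i - 1)))"

lemma lam_pos: "0 < lam" using K1 by (simp add: lam_def)

text \<open>Averaged over \<open>u\<close>, at least \<open>lam * d ^ i / n * card X\<close>
  elements of \<open>X\<close> are at distance \<open>i\<close> from \<open>u\<close>; the threshold
  is half of that. Cauchy-Schwarz on the vertices above it, with \<open>codegree\<close> controlling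
  the second moment, yields the fraction \<open>alpha\<close>.\<close>

lemma heavy_vertices:
  assumes Bn: "B * real (card V) = 4 * M * d ^ (i + 1)"
    and X: "X \<subseteq> V" "X \<noteq> {}" "real (card V) \<le> real (card X) * d ^ i"
  shows "alpha * real (card V) \<le>
    real (card {u \<in> V. lam * d ^ i / (2 * real (card V)) * real (card X) \<le> real (card {x \<in> X. D u x = enat i})})"
proof -
  define n m C \<theta> where "n = real (card V)" and "m = real (card X)"
    and "C = codeg_const M (i - 1)" and "\<theta> = lam * d ^ i / (2 * n) * m"
  define g where "g u = real (card {x \<in> X. D u x = enat i})" for u
  define A where "A = {u \<in> V. \<theta> \<le> g u}"
  have finX: "finite X" using X finV finite_subset by blast
  then have n0: "0 < n" and m0: "0 < m"
    using X finV by (auto simp: n_def m_def card_gt_0_iff)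
  have C0: "0 \<le> C" unfolding C_def by (rule codeg_const_nonneg[OF M0])
  have Mpos: "0 < M" by (simp add: M_def)
  have d0: "0 < d" using d1 by simp
  have SV: "{u \<in> V. D u x = enat i} = {u. D u x = enat i}" if "x \<in> X" for x
    using that X D_le_in_V[of x _ i] D_sym by fastforce

  have "m * (lam * d ^ i) = (\<Sum>x\<in>X. (d / (16 * K)) ^ i)"
    by (simp add: m_def lam_def power_divide power_mult_distrib)
  also have "\<dots> \<le> (\<Sum>x\<in>X. real (card {u \<in> V. D u x = enat i}))"
    using sphere_ge X SV by (intro sum_mono) auto
  also have "\<dots> = (\<Sum>u\<in>V. g u)"
    unfolding g_def real_of_card by (rule sum.swap_restrict[OF finX finV])
  finally have sum_g: "m * (lam * d ^ i) \<le> (\<Sum>u\<in>V. g u)" .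

  \<comment> \<open>A square counts ordered pairs from \<open>X\<close> that are both at distance
    \<open>i\<close> from \<open>u\<close>. Exchanging the sums turns these into sphere sizes on the
    diagonal and codegrees off it.\<close>
  have "(\<Sum>u\<in>V. (g u)\<^sup>2) = (\<Sum>u\<in>V. real (card {z \<in> X \<times> X. D u (fst z) = enat i \<and> D u (snd z) = enat i}))"
  proof (rule sum.cong)
    fix u
    have "{z \<in> X \<times> X. D u (fst z) = enat i \<and> D u (snd z) = enat i} =
        {x \<in> X. D u x = enat i} \<times> {x \<in> X. D u x = enat i}" by auto
    then show "(g u)\<^sup>2 = real (card {z \<in> X \<times> X. D u (fst z) = enat i \<and> D u (snd z) = enat i})"
      by (simp add: g_def power2_eq_square card_cartesian_product)
  qed simp
  also have "\<dots> = (\<Sum>z\<in>X \<times> X. real (card {u \<in> V. D u (fst z) = enat i \<and> D u (snd z) = enat i}))"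
    unfolding real_of_card using finX by (intro sum.swap_restrict[OF finV]) auto
  also have "\<dots> \<le> (\<Sum>z\<in>X \<times> X. (if fst z = snd z then M * d ^ i else 0) + C * d ^ (i - 1) * B)"
  proof (rule sum_mono)
    fix z assume z: "z \<in> X \<times> X"
    show "real (card {u \<in> V. D u (fst z) = enat i \<and> D u (snd z) = enat i})
        \<le> (if fst z = snd z then M * d ^ i else 0) + C * d ^ (i - 1) * B"
    proof (cases "fst z = snd z")
      case True
      have "fst z \<in> V" using z X by auto
      have "card {u \<in> V. D u (fst z) = enat i \<and> D u (snd z) = enat i} \<le> card {u. D (fst z) u \<le> enat i}"
        using finite_ball[OF \<open>fst z \<in> V\<close>, of i] by (intro card_mono) (auto simp: True D_sym[of _ "snd z"])
      also have "real \<dots> \<le> M * d ^ i" using \<open>fst z \<in> V\<close> by (intro ball_le) auto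
      also have "\<dots> \<le> M * d ^ i + C * d ^ (i - 1) * B" using C0 B0 d0 by simp
      finally show ?thesis using True by simp
    next
      case False
      have "{u \<in> V. D u (fst z) = enat i \<and> D u (snd z) = enat i} = {u. D u (fst z) = enat i \<and> D u (snd z) = enat i}"
        using SV[of "fst z"] z by auto
      moreover have "fst z \<in> V" "snd z \<in> V" using z X by auto
      ultimately show ?thesis using codegree[of "fst z" "snd z"] False by (simp add: C_def)
    qed
  qed
  also have "\<dots> = (\<Sum>x\<in>X. \<Sum>y\<in>X. if x = y then M * d ^ i else 0) + (m * m) * (C * d ^ (i - 1) * B)"
    by (simp add: sum.distrib sum.cartesian_product split_beta card_cartesian_product m_def)
  also have "(\<Sum>x\<in>X. \<Sum>y\<in>X. if x = y then M * d ^ i else 0) = m * (M * d ^ i)"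
    using finX by (simp add: m_def)
  finally have sum_g2: "(\<Sum>u\<in>V. (g u)\<^sup>2) \<le> m * (M * d ^ i) + m\<^sup>2 * (C * d ^ (i - 1) * B)"
    by (simp add: power2_eq_square)

  have dd: "d ^ (i - 1) * d ^ (i + 1) = (d ^ i)\<^sup>2"
    using i1 by (cases i) (simp_all add: power2_eq_square)
  have "n * (\<Sum>u\<in>V. (g u)\<^sup>2) \<le> n * (m * (M * d ^ i) + m\<^sup>2 * (C * d ^ (i - 1) * B))"
    using sum_g2 n0 by simp
  also have "\<dots> = n * (m * M * d ^ i) + m\<^sup>2 * C * d ^ (i - 1) * (B * n)"
    by (simp add: algebra_simps)
  also have "\<dots> = n * (m * M * d ^ i) + m\<^sup>2 * C * 4 * M * (d ^ (i - 1) * d ^ (i + 1))"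
    using Bn by (simp add: n_def)
  \<comment> \<open>The diagonal term is absorbed because \<open>X\<close> is large enough:
    \<open>n \<le> m * d ^ i\<close>.\<close>
  also have "\<dots> \<le> (m * d ^ i) * (m * M * d ^ i) + m\<^sup>2 * C * 4 * M * (d ^ i)\<^sup>2"
    unfolding dd using X(3) m0 Mpos d0
    by (intro add_mono mult_right_mono) (auto simp: n_def m_def C0)
  also have "\<dots> = (m * d ^ i)\<^sup>2 * (M * (1 + 4 * C))"
    by (simp add: algebra_simps power2_eq_square)
  finally have sum_g2': "n * (\<Sum>u\<in>V. (g u)\<^sup>2) \<le> (m * d ^ i)\<^sup>2 * (M * (1 + 4 * C))" .

  have finA: "finite A" and AV: "A \<subseteq> V" using finV by (auto simp: A_def)
  have \<theta>0: "0 < \<theta>" using lam_pos d0 n0 m0 by (simp add: \<theta>_def)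
  \<comment> \<open>Vertices below \<open>\<theta>\<close> contribute at most
    \<open>n * \<theta>\<close>, half of the lower bound in \<open>sum_g\<close>, so the other half
    comes from \<open>A\<close>.\<close>
  have "(\<Sum>u\<in>V. g u) = (\<Sum>u\<in>V - A. g u) + (\<Sum>u\<in>A. g u)"
    by (rule sum.subset_diff[OF AV finV])
  also have "(\<Sum>u\<in>V - A. g u) \<le> (\<Sum>u\<in>V - A. \<theta>)"
    by (intro sum_mono) (auto simp: A_def)
  also have "\<dots> \<le> n * \<theta>"
    unfolding n_def using \<theta>0 finV by (auto intro!: mult_right_mono card_mono)
  also have "n * \<theta> = m * (lam * d ^ i) / 2" using n0 by (simp add: \<theta>_def)
  finally have "m * (lam * d ^ i) / 2 \<le> (\<Sum>u\<in>A. g u)" using sum_g by simp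
  then have "(m * (lam * d ^ i) / 2)\<^sup>2 \<le> (\<Sum>u\<in>A. g u)\<^sup>2"
    using m0 lam_pos d0 by (intro power_mono) auto
  also have "\<dots> \<le> (\<Sum>u\<in>A. (g u)\<^sup>2) * real (card A)"
    by (rule sum_squared_le_sum_of_squares)
  also have "\<dots> \<le> (\<Sum>u\<in>V. (g u)\<^sup>2) * real (card A)"
    using AV finV by (intro mult_right_mono sum_mono2) auto
  finally have "n * (m * (lam * d ^ i) / 2)\<^sup>2 \<le> n * ((\<Sum>u\<in>V. (g u)\<^sup>2) * real (card A))"
    using n0 by simp
  also have "\<dots> \<le> ((m * d ^ i)\<^sup>2 * (M * (1 + 4 * C))) * real (card A)"
    using mult_right_mono[OF sum_g2', of "real (card A)"] by (simp add: mult.assoc)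
  finally have "(m * d ^ i)\<^sup>2 * (n * lam\<^sup>2 / 4) \<le> (m * d ^ i)\<^sup>2 * (M * (1 + 4 * C) * real (card A))"
    by (simp add: power_mult_distrib power_divide mult_ac)
  then have "n * lam\<^sup>2 / 4 \<le> M * (1 + 4 * C) * real (card A)"
    using m0 d0 by (subst (asm) mult_le_cancel_left_pos) auto
  then have "alpha * n \<le> real (card A)"
  proof -
    have "0 < 4 * M * (1 + 4 * C)" using Mpos C0 by (intro mult_pos_pos) auto
    moreover have "alpha * n = lam\<^sup>2 * n / (4 * M * (1 + 4 * C))" by (simp add: alpha_def C_def)
    ultimately show ?thesis
      using \<open>n * lam\<^sup>2 / 4 \<le> M * (1 + 4 * C) * real (card A)\<close>
      by (simp add: pos_divide_le_eq mult_ac)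
  qed
  then show ?thesis by (simp add: A_def \<theta>_def g_def n_def m_def)
qed

text \<open>A neighbour \<open>v\<close> of \<open>u\<close> is bad if more than half of
  \<open>G u\<close> is within distance \<open>i\<close> of \<open>v\<close>. By double counting
  with \<open>few_back\<close>, a heavy vertex has at most \<open>2 * B\<close> bad neighbours.
  These are too few to spoil every edge inside the dense set \<open>A\<close> of heavy vertices, so
  some edge is bad in neither direction.\<close>

lemma heavy_edge:
  assumes Bn: "B * real (card V) = 4 * M * d ^ (i + 1)"
    and dense: "\<And>A. A \<subseteq> V \<Longrightarrow> alpha * real (card V) \<le> real (card A) \<Longrightarrow>
      4 * B * real (card V) < real (card (E \<inter> A \<times> A))"
    and X: "X \<subseteq> V" "X \<noteq> {}" "real (card V) \<le> real (card X) * d ^ i"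
  obtains u v where "(u, v) \<in> E"
    "lam * d ^ i / (4 * real (card V)) * real (card X) \<le> real (card {x \<in> X. D u x < D v x})"
    "lam * d ^ i / (4 * real (card V)) * real (card X) \<le> real (card {x \<in> X. D v x < D u x})"
proof -
  define \<theta> where "\<theta> = lam * d ^ i / (2 * real (card V)) * real (card X)"
  define G where "G u = {x \<in> X. D u x = enat i}" for u
  define A where "A = {u \<in> V. \<theta> \<le> real (card (G u))}"
  define bad where "bad u = {v. (u, v) \<in> E \<and> real (card (G u)) < 2 * real (card {x \<in> G u. D v x \<le> enat i})}" for u
  have finX: "finite X" using X finV finite_subset by blast
  have finG: "finite (G u)" for u using finX by (simp add: G_def)
  have AV: "A \<subseteq> V" and finA: "finite A" using finV by (auto simp: A_def)
  have \<theta>0: "0 < \<theta>"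
    using lam_pos d1 X finX finV by (auto simp: \<theta>_def card_gt_0_iff intro!: mult_pos_pos divide_pos_pos)
  have bad_sub: "bad u \<subseteq> {v. (u, v) \<in> E}" for u by (auto simp: bad_def)
  have fin_bad: "finite (bad u)" for u using bad_sub finite_nbr finite_subset by blast
  have card_bad: "real (card (bad u)) \<le> 2 * B" if u: "u \<in> A" for u
  proof -
    have g0: "0 < real (card (G u))" using u \<theta>0 by (auto simp: A_def)
    have "real (card (bad u)) * real (card (G u)) \<le> (\<Sum>v\<in>bad u. 2 * real (card {x \<in> G u. D v x \<le> enat i}))"
      by (rule sum_bounded_below) (auto simp: bad_def)
    also have "\<dots> \<le> (\<Sum>v | (u, v) \<in> E. 2 * real (card {x \<in> G u. D v x \<le> enat i}))"
      using bad_sub by (intro sum_mono2) auto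
    also have "\<dots> = 2 * (\<Sum>v | (u, v) \<in> E. real (card {x \<in> G u. D v x \<le> enat i}))"
      by (simp add: sum_distrib_left)
    also have "(\<Sum>v | (u, v) \<in> E. real (card {x \<in> G u. D v x \<le> enat i})) =
        (\<Sum>x\<in>G u. real (card {v \<in> {v. (u, v) \<in> E}. D v x \<le> enat i}))"
      unfolding real_of_card by (rule sum.swap_restrict[OF finite_nbr finG])
    also have "\<dots> \<le> real (card (G u)) * B"
    proof (rule sum_bounded_above)
      fix x assume x: "x \<in> G u"
      then show "real (card {v \<in> {v. (u, v) \<in> E}. D v x \<le> enat i}) \<le> B"
        using few_back[of u x i] u X AV by (auto simp: G_def)
    qed
    finally have "real (card (bad u)) * real (card (G u)) \<le> (2 * B) * real (card (G u))"
      by (simp add: mult_ac)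
    then show ?thesis using g0 by simp
  qed
  have "\<exists>u v. (u, v) \<in> E \<inter> A \<times> A \<and> v \<notin> bad u \<and> u \<notin> bad v"
  proof (rule ccontr)
    assume *: "\<not> ?thesis"
    let ?P = "Sigma A bad"
    have "real (card ?P) = (\<Sum>u\<in>A. real (card (bad u)))"
      using finA fin_bad by (subst card_SigmaI) auto
    also have "\<dots> \<le> real (card A) * (2 * B)"
      by (rule sum_bounded_above) (rule card_bad)
    also have "\<dots> \<le> real (card V) * (2 * B)"
      using AV finV B0 by (intro mult_right_mono) (auto intro: card_mono)
    finally have P: "real (card ?P) \<le> real (card V) * (2 * B)" .
    have finP: "finite ?P" using finA fin_bad by auto
    \<comment> \<open>Otherwise every ordered edge inside \<open>A\<close> is bad from one of its
      two ends; the swapped copy of \<open>?P\<close> accounts for the second end.\<close>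
    have "E \<inter> A \<times> A \<subseteq> ?P \<union> prod.swap ` ?P" using * by force
    then have "card (E \<inter> A \<times> A) \<le> card (?P \<union> prod.swap ` ?P)"
      using finP by (intro card_mono) auto
    also have "\<dots> \<le> card ?P + card (prod.swap ` ?P)" by (rule card_Un_le)
    also have "\<dots> \<le> card ?P + card ?P" using card_image_le[OF finP] by simp
    finally have "real (card (E \<inter> A \<times> A)) \<le> real (card ?P) + real (card ?P)" by linarith
    also have "\<dots> \<le> 4 * B * real (card V)" using P by (simp add: mult_ac)
    finally have "real (card (E \<inter> A \<times> A)) \<le> 4 * B * real (card V)" .
    moreover have "alpha * real (card V) \<le> real (card A)"
      using heavy_vertices[OF Bn X] by (simp add: A_def \<theta>_def G_def)
    ultimately show False using dense[OF AV] by simp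
  qed
  then obtain u v where uv: "(u, v) \<in> E" "u \<in> A" "v \<in> A" "v \<notin> bad u" "u \<notin> bad v" by auto
  \<comment> \<open>If \<open>v\<close> is not bad, at least half of \<open>G u\<close> lies beyond
    distance \<open>i\<close> from \<open>v\<close> and is therefore strictly closer to
    \<open>u\<close>.\<close>
  have sep: "\<theta> / 2 \<le> real (card {x \<in> X. D u x < D v x})" if "(u, v) \<in> E" "u \<in> A" "v \<notin> bad u" for u v
  proof -
    have "card (G u) \<le> card ({x \<in> G u. D v x \<le> enat i} \<union> {x \<in> X. D u x < D v x})"
      using finG finX by (intro card_mono) (auto simp: G_def)
    also have "\<dots> \<le> card {x \<in> G u. D v x \<le> enat i} + card {x \<in> X. D u x < D v x}"
      by (rule card_Un_le)
    finally have "real (card (G u)) \<le> real (card {x \<in> G u. D v x \<le> enat i}) + real (card {x \<in> X. D u x < D v x})"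
      by linarith
    moreover have "2 * real (card {x \<in> G u. D v x \<le> enat i}) \<le> real (card (G u))"
      using that by (auto simp: bad_def)
    moreover have "\<theta> \<le> real (card (G u))" using that by (auto simp: A_def)
    ultimately show ?thesis by linarith
  qed
  have "\<theta> / 2 = lam * d ^ i / (4 * real (card V)) * real (card X)" by (simp add: \<theta>_def)
  then have "lam * d ^ i / (4 * real (card V)) * real (card X) = \<theta> / 2" by simp
  moreover have "(v, u) \<in> E" using uv(1) E_sym by blast
  ultimately show ?thesis
    using sep[OF uv(1,2,4)] sep[OF _ uv(3,5)] by (intro that[OF uv(1)]) (simp_all only:)
qed

end

section \<open>Strategies of the two players\<close>

text \<open>A strategy that looks at the current candidates refers to the sets it produces itself.
  Computing these sets first, from the choice function \<open>q\<close> alone, avoids the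
  circularity.\<close>

primrec greedy_candidates :: "('a set \<Rightarrow> 'a \<times> 'a) \<Rightarrow> 'a set \<Rightarrow> 'a rel \<Rightarrow> bool list \<Rightarrow> 'a set" where
  "greedy_candidates q V E [] = V"
| "greedy_candidates q V E (b # h) =
     (let X = greedy_candidates q V E h; u = fst (q X); v = snd (q X) in
        if b then {x \<in> X. graph_dist E u x \<le> graph_dist E v x}
        else {x \<in> X. graph_dist E v x \<le> graph_dist E u x})"

lemma candidates_greedy:
  "candidates V E (\<lambda>h. q (greedy_candidates q V E h)) h = greedy_candidates q V E h"
  by (induction h) (auto simp: Let_def split_beta)

lemma query_number_le: "locates_within V E Q t \<sigma> \<Longrightarrow> query_number V E Q \<le> enat t"
  unfolding query_number_def by (rule INF_lower) auto

lemma query_number_ge: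
  "(\<And>t \<sigma>. locates_within V E Q t \<sigma> \<Longrightarrow> enat k \<le> enat t) \<Longrightarrow> enat k \<le> query_number V E Q"
  unfolding query_number_def by (rule INF_greatest) auto

lemma query_number_antimono: "Q \<subseteq> Q' \<Longrightarrow> query_number V E Q' \<le> query_number V E Q"
  unfolding query_number_def locates_within_def by (intro INF_superset_mono) blast+

text \<open>Two phases: \<open>t\<close> queries shrink the candidates by a factor
  \<open>1 - \<rho>\<close> each until at most \<open>m\<close> are left, then \<open>m\<close>
  queries exclude at least one candidate each.\<close>

lemma query_number_upper:
  fixes \<rho> :: real
  assumes "finite V" "0 \<le> \<rho>" "\<rho> \<le> 1"
    and small: "\<And>X. X \<subseteq> V \<Longrightarrow> 2 \<le> card X \<Longrightarrow> \<exists>(u, v)\<in>Q.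
      (\<exists>x\<in>X. graph_dist E u x < graph_dist E v x) \<and> (\<exists>x\<in>X. graph_dist E v x < graph_dist E u x)"
    and large: "\<And>X. X \<subseteq> V \<Longrightarrow> 2 \<le> card X \<Longrightarrow> m \<le> card X \<Longrightarrow> \<exists>(u, v)\<in>Q.
      (\<exists>x\<in>X. graph_dist E u x < graph_dist E v x) \<and> (\<exists>x\<in>X. graph_dist E v x < graph_dist E u x) \<and>
      \<rho> * card X \<le> card {x \<in> X. graph_dist E u x < graph_dist E v x} \<and>
      \<rho> * card X \<le> card {x \<in> X. graph_dist E v x < graph_dist E u x}"
    and t: "real (card V) * (1 - \<rho>) ^ t \<le> m"
  shows "query_number V E Q \<le> enat (t + m)"
proof -
  define good where "good X e \<longleftrightarrow> (case e of (u, v) \<Rightarrow> (u, v) \<in> Q \<and>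
      (\<exists>x\<in>X. graph_dist E u x < graph_dist E v x) \<and> (\<exists>x\<in>X. graph_dist E v x < graph_dist E u x) \<and>
      (m \<le> card X \<longrightarrow> \<rho> * card X \<le> card {x \<in> X. graph_dist E u x < graph_dist E v x} \<and>
        \<rho> * card X \<le> card {x \<in> X. graph_dist E v x < graph_dist E u x}))" for X e
  define q where "q X = (SOME e. good X e)" for X
  have q: "good X (q X)" if "X \<subseteq> V" "2 \<le> card X" for X
    unfolding q_def
  proof (rule someI_ex, cases "m \<le> card X")
    case True
    then show "\<exists>e. good X e" using large[OF that True] by (fastforce simp: good_def)
  next
    case False
    then show "\<exists>e. good X e" using small[OF that] by (fastforce simp: good_def)
  qed
  define cs where "cs = greedy_candidates q V E"
  have cs_sub: "cs (b # h) \<subseteq> cs h" for b h by (auto simp: cs_def Let_def)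
  have cs_V: "cs h \<subseteq> V" for h
    by (induction h) (use cs_sub in \<open>auto simp: cs_def\<close>)
  have fin: "finite (cs h)" for h using cs_V assms(1) finite_subset by blast
  have cs_le: "card (cs (b # h)) \<le> card (cs h)" for b h
    using cs_sub fin by (intro card_mono) auto
  have step: "card (cs (b # h)) < card (cs h) \<and>
      (m \<le> card (cs h) \<longrightarrow> real (card (cs (b # h))) \<le> (1 - \<rho>) * card (cs h))"
    if c: "2 \<le> card (cs h)" for b h
  proof -
    obtain u v where uv: "q (cs h) = (u, v)" by fastforce
    \<comment> \<open>The part that the reply excludes. Ties survive both replies, hence the strict
      inequalities.\<close>
    define R where "R = (if b then {x \<in> cs h. graph_dist E v x < graph_dist E u x}
        else {x \<in> cs h. graph_dist E u x < graph_dist E v x})"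
    have R: "R \<subseteq> cs h" "R \<noteq> {}" "m \<le> card (cs h) \<Longrightarrow> \<rho> * card (cs h) \<le> card R"
      using q[OF cs_V c] uv by (auto simp: R_def good_def)
    have "cs (b # h) = cs h - R"
      using uv by (auto simp: cs_def Let_def R_def not_less)
    then have "card (cs (b # h)) = card (cs h) - card R" "card R \<le> card (cs h)" "0 < card R"
      using R fin[of h] finite_subset[OF R(1) fin[of h]]
      by (auto simp: card_Diff_subset card_gt_0_iff intro: card_mono)
    then show ?thesis using R(3) by (auto simp: algebra_simps of_nat_diff)
  qed
  \<comment> \<open>Progress is only available while two candidates remain, so the target size is
    \<open>max 1 m\<close>, which also covers \<open>m = 0\<close>.\<close>
  have phase1: "card (cs h) \<le> max 1 m \<or> real (card (cs h)) \<le> card V * (1 - \<rho>) ^ length h" for h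
  proof (induction h)
    case (Cons b h)
    show ?case
    proof (cases "card (cs h) \<le> max 1 m")
      case True
      then show ?thesis using cs_le[of b h] by linarith
    next
      case False
      then have "real (card (cs (b # h))) \<le> (1 - \<rho>) * card (cs h)"
        using step[of h b] by auto
      also have "\<dots> \<le> (1 - \<rho>) * (card V * (1 - \<rho>) ^ length h)"
        using False Cons assms by (intro mult_left_mono) auto
      finally show ?thesis by (simp add: mult_ac)
    qed
  qed (simp add: cs_def)
  have phase2: "card (cs h) \<le> max 1 (m - l)" if "length h = t + l" for h l
    using that
  proof (induction l arbitrary: h)
    case 0
    then show ?case using phase1[of h] t by (auto simp: le_max_iff_disj)
  next
    case (Suc l)
    then obtain b h' where h: "h = b # h'" "length h' = t + l" by (cases h) auto
    show ?case
    proof (cases "2 \<le> card (cs h')")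
      case True
      then show ?thesis using step[OF True, of b] Suc.IH[OF h(2)] h(1) by auto
    next
      case False
      then show ?thesis using cs_le[of b h'] h(1) by auto
    qed
  qed
  have "locates_within V E Q (t + m) (\<lambda>h. q (cs h))"
    unfolding locates_within_def cs_def candidates_greedy
  proof (intro conjI allI impI; fold cs_def)
    fix h assume "length h < t + m \<and> cs h \<noteq> {} \<and> card (cs h) \<noteq> 1"
    then have "2 \<le> card (cs h)" using fin[of h] by (metis One_nat_def Suc_1 card_0_eq le_SucE not_less_eq_eq le_zero_eq)
    from q[OF cs_V this] show "q (cs h) \<in> Q" by (auto simp: good_def)
  next
    fix h assume "length h = t + m \<and> cs h \<noteq> {}"
    moreover from this have "0 < card (cs h)" using fin[of h] by (simp add: card_gt_0_iff)
    ultimately show "card (cs h) = 1" using phase2[of h m] by simp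
  qed
  then show ?thesis by (rule query_number_le)
qed

text \<open>The adversary that always names the first vertex \<open>u\<close> of a query \<open>(u, v)\<close> only ever
  excludes vertices at distance at most \<open>i\<close> from \<open>v\<close>.\<close>

lemma query_number_lower:
  assumes "finite V"
    and diam: "\<And>x y. x \<in> V \<Longrightarrow> y \<in> V \<Longrightarrow> graph_dist E x y \<le> enat (Suc i)"
    and cover: "\<And>W. W \<subseteq> V \<Longrightarrow> card W \<le> k \<Longrightarrow> \<exists>x\<in>V. \<forall>w\<in>W. \<not> graph_dist E w x \<le> enat i"
  shows "enat k \<le> query_number V E (V \<times> V)"
proof (rule query_number_ge)
  fix t \<sigma> assume loc: "locates_within V E (V \<times> V) t \<sigma>"
  define cs where "cs = candidates V E \<sigma>"
  \<comment> \<open>Fewer than \<open>k\<close> balls miss some \<open>x\<close>. Adding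
    \<open>x\<close> as one more centre gives at most \<open>k\<close> balls, and these miss some
    \<open>y\<close>, which differs from \<open>x\<close> because \<open>x\<close> lies in its own
    ball.\<close>
  have two: "2 \<le> card X" if W: "W \<subseteq> V" "card W < k" and X: "X \<subseteq> V" "V - (\<Union>w\<in>W. {x. graph_dist E w x \<le> enat i}) \<subseteq> X" for W X
  proof -
    have fin: "finite X" "finite W" using W X assms(1) finite_subset by blast+
    obtain x where x: "x \<in> V" "\<forall>w\<in>W. \<not> graph_dist E w x \<le> enat i" using cover[of W] W by auto
    moreover have "card (insert x W) \<le> k" using W(2) fin by (simp add: card_insert_if)
    ultimately obtain y where y: "y \<in> V" "\<forall>w\<in>insert x W. \<not> graph_dist E w y \<le> enat i"
      using cover[of "insert x W"] W by auto
    have "x \<noteq> y" using y(2) by (auto simp: graph_dist_le_iff)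
    moreover have "{x, y} \<subseteq> X" using x y X by auto
    ultimately show ?thesis using card_mono[OF fin(1), of "{x, y}"] by simp
  qed
  show "enat k \<le> enat t"
  proof (rule ccontr)
    assume "\<not> enat k \<le> enat t"
    then have tk: "t < k" by simp
    \<comment> \<open>\<open>W\<close> collects the second vertices of the first \<open>l\<close>
      queries along the history in which every reply is \<open>True\<close>.\<close>
    have "\<exists>W \<subseteq> V. card W \<le> l \<and> V - (\<Union>w\<in>W. {x. graph_dist E w x \<le> enat i}) \<subseteq> cs (replicate l True) \<and>
        cs (replicate l True) \<subseteq> V" if "l \<le> t" for l
      using that
    proof (induction l)
      case 0
      then show ?case by (intro exI[of _ "{}"]) (auto simp: cs_def)
    next
      case (Suc l)
      let ?X = "cs (replicate l True)"
      obtain W where W: "W \<subseteq> V" "card W \<le> l"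
        "V - (\<Union>w\<in>W. {x. graph_dist E w x \<le> enat i}) \<subseteq> ?X" "?X \<subseteq> V"
        using Suc by auto
      \<comment> \<open>The next query is known to be legal only while the target is not located;
        two remaining candidates ensure this, and hence \<open>v \<in> V\<close>.\<close>
      then have "2 \<le> card ?X" using tk Suc.prems by (intro two[of W]) auto
      then have "?X \<noteq> {}" "card ?X \<noteq> 1" by auto
      then have "\<sigma> (replicate l True) \<in> V \<times> V"
        using loc Suc.prems unfolding locates_within_def cs_def by auto
      then obtain u v where uv: "\<sigma> (replicate l True) = (u, v)" "u \<in> V" "v \<in> V" by auto
      have X': "cs (replicate (Suc l) True) = {x \<in> ?X. graph_dist E u x \<le> graph_dist E v x}"
        by (simp add: cs_def uv)
      \<comment> \<open>An excluded vertex is strictly closer to \<open>v\<close> than to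
        \<open>u\<close>, and its distance from \<open>u\<close> is at most
        \<open>i + 1\<close>.\<close>
      have "graph_dist E v x \<le> enat i" if "x \<in> V" "\<not> graph_dist E u x \<le> graph_dist E v x" for x
      proof -
        have "graph_dist E v x < graph_dist E u x" using that by simp
        also have "\<dots> \<le> enat (Suc i)" using diam uv that by simp
        finally show ?thesis by (cases "graph_dist E v x") auto
      qed
      then have "V - (\<Union>w\<in>insert v W. {x. graph_dist E w x \<le> enat i}) \<subseteq> cs (replicate (Suc l) True)"
        unfolding X' using W(3) by auto
      moreover have "card (insert v W) \<le> Suc l"
        using W finite_subset[OF W(1) assms(1)] by (simp add: card_insert_if)
      ultimately show ?case using W uv X' by (intro exI[of _ "insert v W"]) auto
    qed
    from this[of t] obtain W where W: "W \<subseteq> V" "card W \<le> t"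
        "V - (\<Union>w\<in>W. {x. graph_dist E w x \<le> enat i}) \<subseteq> cs (replicate t True)" "cs (replicate t True) \<subseteq> V"
      by auto
    then have "2 \<le> card (cs (replicate t True))" using tk by (intro two[of W]) auto
    moreover have "cs (replicate t True) \<noteq> {}" using calculation by auto
    ultimately show False using loc unfolding locates_within_def cs_def
      by (metis length_replicate Suc_1 Suc_n_not_le_n One_nat_def)
  qed
qed

section \<open>Independent edges\<close>

definition merge :: "'e set \<Rightarrow> ('e \<Rightarrow> 'b) \<Rightarrow> ('e \<Rightarrow> 'b) \<Rightarrow> 'e \<Rightarrow> 'b" where
  "merge F f g e = (if e \<in> F then f e else g e)"

text \<open>Fubini: expose the coordinates outside \<open>F\<close> first and bound the conditional
  probability by \<open>c\<close> for every outcome. A necessary condition \<open>Q'\<close> on the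
  exposed part survives as a factor, which permits iteration over disjoint blocks.\<close>

lemma prob_Pi_pmf_split_le:
  assumes "finite D" "F \<subseteq> D" "0 \<le> c"
    and cond: "\<And>g. measure_pmf.prob (Pi_pmf F dflt p) {f. Q (merge F f g)} \<le> c"
    and Q': "\<And>f g. Q (merge F f g) \<Longrightarrow> Q' g"
  shows "measure_pmf.prob (Pi_pmf D dflt p) {h. Q h} \<le> c * measure_pmf.prob (Pi_pmf (D - F) dflt p) {g. Q' g}"
proof -
  let ?P = "Pi_pmf F dflt p" and ?R = "Pi_pmf (D - F) dflt p"
  have "finite F" using assms finite_subset by blast
  have "Pi_pmf D dflt p = Pi_pmf (F \<union> (D - F)) dflt p" using assms(2) by (simp add: Un_absorb1)
  also have "\<dots> = map_pmf (\<lambda>(f, g) e. if e \<in> F then f e else g e) (pair_pmf ?P ?R)"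
    using assms(1) \<open>finite F\<close> by (intro Pi_pmf_union) auto
  also have "\<dots> = map_pmf (\<lambda>(g, f). merge F f g) (pair_pmf ?R ?P)"
    by (subst pair_commute_pmf) (simp add: map_pmf_comp case_prod_unfold merge_def[abs_def] o_def cong: if_cong)
  finally have "emeasure (Pi_pmf D dflt p) {h. Q h} =
      emeasure (map_pmf (\<lambda>(g, f). merge F f g) (pair_pmf ?R ?P)) {h. Q h}" by simp
  also have "\<dots> = (\<integral>\<^sup>+g. \<integral>\<^sup>+f. indicator {f. Q (merge F f g)} f \<partial>?P \<partial>?R)"
    by (subst nn_integral_indicator[symmetric], simp, subst nn_integral_map_pmf)
       (simp only: nn_integral_pair_pmf' case_prod_conv, intro nn_integral_cong, simp add: indicator_def)
  also have "\<dots> = (\<integral>\<^sup>+g. emeasure ?P {f. Q (merge F f g)} \<partial>?R)" by simp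
  also have "\<dots> \<le> (\<integral>\<^sup>+g. ennreal c * indicator {g. Q' g} g \<partial>?R)"
  proof (rule nn_integral_mono)
    fix g
    show "emeasure ?P {f. Q (merge F f g)} \<le> ennreal c * indicator {g. Q' g} g"
    proof (cases "Q' g")
      case True
      then show ?thesis
        using cond[of g] by (simp add: measure_pmf.emeasure_eq_measure ennreal_leI)
    next
      case False
      then have "{f. Q (merge F f g)} = {}" using Q' by blast
      then show ?thesis by simp
    qed
  qed
  also have "\<dots> = ennreal c * emeasure ?R {g. Q' g}"
    by (simp add: nn_integral_cmult_indicator)
  finally show ?thesis
    using assms(3) by (simp add: measure_pmf.emeasure_eq_measure ennreal_mult[symmetric])
qed

section \<open>Counting successes among independent coordinates\<close>

context
  fixes D :: "'e set" and p :: real and P :: "('e \<Rightarrow> bool) pmf"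
  assumes finD: "finite D" and p01: "0 \<le> p" "p \<le> 1"
    and P_def: "P = Pi_pmf D False (\<lambda>_. bernoulli_pmf p)"
begin

lemma expectation_power_count:
  assumes "F \<subseteq> D" "0 \<le> s"
  shows "measure_pmf.expectation P (\<lambda>f. s ^ card {e \<in> F. f e}) = (1 - p + p * s) ^ card F"
    and "integrable (measure_pmf P) (\<lambda>f. s ^ card {e \<in> F. f e})"
proof -
  have finF: "finite F" using assms finD finite_subset by blast
  \<comment> \<open>Written as a product over all coordinates, with factor 1 outside
    \<open>F\<close>, the power has an expectation that factorises by independence.\<close>
  have eq: "s ^ card {e \<in> F. f e} = (\<Prod>e\<in>D. if e \<in> F \<and> f e then s else 1)" for f
  proof -
    have "(\<Prod>e\<in>D. if e \<in> F \<and> f e then s else 1) = (\<Prod>e\<in>{e \<in> D. e \<in> F \<and> f e}. s)"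
      by (rule prod.inter_filter[OF finD, symmetric])
    also have "{e \<in> D. e \<in> F \<and> f e} = {e \<in> F. f e}" using assms(1) by auto
    finally show ?thesis by simp
  qed
  have int: "integrable (measure_pmf (bernoulli_pmf p)) (\<lambda>b. if e \<in> F \<and> b then s else 1)" for e
    by (rule integrable_measure_pmf_finite) simp
  have "measure_pmf.expectation P (\<lambda>f. s ^ card {e \<in> F. f e}) =
      (\<Prod>e\<in>D. measure_pmf.expectation (bernoulli_pmf p) (\<lambda>b. if e \<in> F \<and> b then s else 1))"
    unfolding eq P_def using assms int by (intro expectation_prod_Pi_pmf[OF finD]) auto
  also have "\<dots> = (\<Prod>e\<in>D. if e \<in> F then 1 - p + p * s else 1)"
    using p01 by (intro prod.cong) auto
  also have "\<dots> = (1 - p + p * s) ^ card F"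
    using assms(1) by (subst prod.inter_filter[OF finD, symmetric]) (simp add: Int_absorb1 Int_def[symmetric] Collect_conj_eq)
  finally show "measure_pmf.expectation P (\<lambda>f. s ^ card {e \<in> F. f e}) = (1 - p + p * s) ^ card F" .
  show "integrable (measure_pmf P) (\<lambda>f. s ^ card {e \<in> F. f e})"
    unfolding eq P_def by (rule integrable_prod_Pi_pmf[OF finD int])
qed

lemma prob_none:
  assumes "F \<subseteq> D"
  shows "measure_pmf.prob P {f. card {e \<in> F. f e} = 0} = (1 - p) ^ card F"
proof -
  have "measure_pmf.prob P {f. card {e \<in> F. f e} = 0} = measure_pmf.expectation P (\<lambda>f. indicat_real {f. card {e \<in> F. f e} = 0} f)"
    by simp
  \<comment> \<open>Since \<open>0 ^ 0 = 1\<close>, the generating function at 0 is the probability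
    of no success.\<close>
  also have "\<dots> = measure_pmf.expectation P (\<lambda>f. 0 ^ card {e \<in> F. f e})"
    by (intro arg_cong[where f = "measure_pmf.expectation P"] ext)
       (auto simp: indicator_def power_0_left)
  also have "\<dots> = (1 - p) ^ card F" using expectation_power_count(1)[OF assms, of 0] by simp
  finally show ?thesis .
qed

lemma prob_none_le:
  assumes "F \<subseteq> D"
  shows "measure_pmf.prob P {f. card {e \<in> F. f e} = 0} \<le> exp (- p * real (card F))"
proof -
  have "(1 - p) ^ card F \<le> exp (- p) ^ card F"
    using p01 exp_ge_add_one_self[of "- p"] by (intro power_mono) auto
  then show ?thesis unfolding prob_none[OF assms] by (simp add: exp_of_nat_mult[symmetric] mult.commute)
qed

text \<open>Chernoff's bound, with the upper tail for \<open>s \<ge> 1\<close> and the lower tail for \<open>s \<le> 1\<close>.\<close>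

lemma prob_count_tail:
  fixes s t :: real
  assumes "F \<subseteq> D" "0 < s" and T: "\<And>k. k \<in> T \<Longrightarrow> s powr t \<le> s ^ k"
  shows "measure_pmf.prob P {f. card {e \<in> F. f e} \<in> T} \<le> s powr (- t) * exp ((s - 1) * p * card F)"
proof -
  have "measure_pmf.prob P {f. card {e \<in> F. f e} \<in> T} \<le>
      measure_pmf.prob P {f \<in> space (measure_pmf P). s powr t \<le> s ^ card {e \<in> F. f e}}"
    using T by (intro measure_pmf.finite_measure_mono) auto
  also have "\<dots> \<le> measure_pmf.expectation P (\<lambda>f. s ^ card {e \<in> F. f e}) / s powr t"
    using assms expectation_power_count(2)[OF assms(1), of s]
    by (intro integral_Markov_inequality_measure[where A = UNIV]) auto
  also have "\<dots> = s powr (- t) * (1 - p + p * s) ^ card F"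
    using assms by (simp add: expectation_power_count powr_minus divide_inverse mult.commute)
  also have "\<dots> \<le> s powr (- t) * exp ((s - 1) * p) ^ card F"
  proof (intro mult_left_mono power_mono)
    show "1 - p + p * s \<le> exp ((s - 1) * p)"
      using exp_ge_add_one_self[of "(s - 1) * p"] by (simp add: algebra_simps)
    show "0 \<le> 1 - p + p * s" using p01 assms(2) by simp
  qed auto
  also have "exp ((s - 1) * p) ^ card F = exp ((s - 1) * p * card F)"
    by (simp add: exp_of_nat_mult[symmetric] mult_ac)
  finally show ?thesis .
qed

lemma prob_count_ge:
  assumes "F \<subseteq> D" "1 \<le> s"
  shows "measure_pmf.prob P {f. t \<le> real (card {e \<in> F. f e})} \<le> s powr (- t) * exp ((s - 1) * p * card F)"
proof -
  have "s powr t \<le> s ^ k" if "t \<le> real k" for k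
    using that assms by (simp add: powr_mono flip: powr_realpow)
  then show ?thesis using prob_count_tail[of F s "{k. t \<le> real k}" t] assms by simp
qed

lemma prob_count_le:
  assumes "F \<subseteq> D" "0 < s" "s \<le> 1"
  shows "measure_pmf.prob P {f. real (card {e \<in> F. f e}) \<le> t} \<le> s powr (- t) * exp ((s - 1) * p * card F)"
proof -
  have "s powr t \<le> s ^ k" if "real k \<le> t" for k
    using that assms by (simp add: powr_mono' flip: powr_realpow)
  then show ?thesis using prob_count_tail[of F s "{k. real k \<le> t}" t] assms by simp
qed

end

text \<open>Disjoint blocks are independent, so they are exposed one at a time. A block of size at
  most \<open>s\<close> is hit with probability at most \<open>1 - (1 - p) ^ s\<close>.\<close>

lemma prob_all_hit:
  assumes "0 \<le> p" "p \<le> 1" "finite D" "finite H"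
    and "\<And>v. v \<in> H \<Longrightarrow> F v \<subseteq> D" "\<And>v. v \<in> H \<Longrightarrow> card (F v) \<le> s"
    and "\<And>v v'. v \<in> H \<Longrightarrow> v' \<in> H \<Longrightarrow> v \<noteq> v' \<Longrightarrow> F v \<inter> F v' = {}"
  shows "measure_pmf.prob (Pi_pmf D False (\<lambda>_. bernoulli_pmf p)) {f. \<forall>v\<in>H. \<exists>e\<in>F v. f e}
    \<le> (1 - (1 - p) ^ s) ^ card H"
  using assms(4,3,5-)
proof (induction H arbitrary: D rule: finite_induct)
  case (insert v H)
  let ?c = "1 - (1 - p) ^ s"
  let ?P = "\<lambda>D. Pi_pmf D False (\<lambda>_. bernoulli_pmf p)"
  have c0: "0 \<le> ?c" using assms(1,2) by (simp add: power_le_one)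
  have FD: "F v \<subseteq> D" using insert.prems by auto
  have fin: "finite (F v)" using FD insert.prems(1) finite_subset by blast
  have disj: "F v' \<inter> F v = {}" if "v' \<in> H" for v' using insert.prems(4)[of v' v] insert.hyps that by auto
  have *: "measure_pmf.prob (?P (F v)) {f. \<exists>e\<in>F v. f e} \<le> ?c"
  proof -
    have "{f. \<exists>e\<in>F v. f e} = UNIV - {f. card {e \<in> F v. f e} = 0}" using fin by auto
    then have "measure_pmf.prob (?P (F v)) {f. \<exists>e\<in>F v. f e} = 1 - (1 - p) ^ card (F v)"
      using prob_none[OF fin assms(1,2) refl order.refl] measure_pmf.prob_compl[of "{f. card {e \<in> F v. f e} = 0}" "?P (F v)"]
      by simp
    moreover have "(1 - p) ^ s \<le> (1 - p) ^ card (F v)"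
      using assms(1,2) insert.prems by (intro power_decreasing) auto
    ultimately show ?thesis by simp
  qed
  have "measure_pmf.prob (?P D) {f. \<forall>v'\<in>insert v H. \<exists>e\<in>F v'. f e} \<le>
      ?c * measure_pmf.prob (?P (D - F v)) {f. \<forall>v'\<in>H. \<exists>e\<in>F v'. f e}"
  proof (rule prob_Pi_pmf_split_le[OF insert.prems(1) FD c0])
    fix g
    have "measure_pmf.prob (?P (F v)) {f. \<forall>v'\<in>insert v H. \<exists>e\<in>F v'. merge (F v) f g e} \<le>
        measure_pmf.prob (?P (F v)) {f. \<exists>e\<in>F v. f e}"
      by (intro measure_pmf.finite_measure_mono) (auto simp: merge_def)
    with * show "measure_pmf.prob (?P (F v)) {f. \<forall>v'\<in>insert v H. \<exists>e\<in>F v'. merge (F v) f g e} \<le> ?c"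
      by linarith
  next
    fix f g assume *: "\<forall>v'\<in>insert v H. \<exists>e\<in>F v'. merge (F v) f g e"
    show "\<forall>v'\<in>H. \<exists>e\<in>F v'. g e"
    proof
      fix v' assume v': "v' \<in> H"
      with * obtain e where e: "e \<in> F v'" "merge (F v) f g e" by auto
      then have "e \<notin> F v" using disj[OF v'] by auto
      with e show "\<exists>e\<in>F v'. g e" by (auto simp: merge_def)
    qed
  qed
  also have "\<dots> \<le> ?c * ?c ^ card H"
  proof (intro mult_left_mono insert.IH c0)
    show "F v' \<subseteq> D - F v" if "v' \<in> H" for v' using insert.prems(2)[of v'] disj[OF that] that by auto
  qed (use insert.prems in auto)
  finally show ?case using insert.hyps by simp
qed auto

section \<open>The random graph in terms of independent edge slots\<close>

definition edge_slots :: "nat \<Rightarrow> (nat \<times> nat) set" where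
  "edge_slots n = {(u, v). 1 \<le> u \<and> u < v \<and> v \<le> n}"

definition slot_pmf :: "nat \<Rightarrow> real \<Rightarrow> (nat \<times> nat \<Rightarrow> bool) pmf" where
  "slot_pmf n p = Pi_pmf (edge_slots n) False (\<lambda>_. bernoulli_pmf p)"

text \<open>Values of \<open>f\<close> outside the slots are ignored, so the result is a simple
  graph for every \<open>f\<close> and not only for those in the support of the
  distribution.\<close>

definition graph_of :: "nat \<Rightarrow> (nat \<times> nat \<Rightarrow> bool) \<Rightarrow> nat rel" where
  "graph_of n f = {(u, v). (u, v) \<in> edge_slots n \<and> f (u, v) \<or> (v, u) \<in> edge_slots n \<and> f (v, u)}"

definition slot :: "nat \<Rightarrow> nat \<Rightarrow> nat \<times> nat" where
  "slot u v = (min u v, max u v)"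

definition star :: "nat \<Rightarrow> nat \<Rightarrow> (nat \<times> nat) set" where
  "star n x = {e \<in> edge_slots n. fst e = x \<or> snd e = x}"

lemma finite_edge_slots: "finite (edge_slots n)"
  by (rule finite_subset[of _ "{1..n} \<times> {1..n}"]) (auto simp: edge_slots_def)

lemma slot_in: "u \<in> {1..n} \<Longrightarrow> v \<in> {1..n} \<Longrightarrow> u \<noteq> v \<Longrightarrow> slot u v \<in> edge_slots n"
  by (auto simp: slot_def edge_slots_def min_def max_def)

lemma slot_in_star: "u \<in> {1..n} \<Longrightarrow> v \<in> {1..n} \<Longrightarrow> u \<noteq> v \<Longrightarrow> slot u v \<in> star n u"
  using slot_in[of u n v] by (auto simp: star_def slot_def min_def max_def)

lemma inj_slot: "inj (slot u)"
  by (rule injI) (auto simp: slot_def min_def max_def split: if_splits)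

lemma in_graph_of_iff:
  "u \<in> {1..n} \<Longrightarrow> v \<in> {1..n} \<Longrightarrow> (u, v) \<in> graph_of n f \<longleftrightarrow> u \<noteq> v \<and> f (slot u v)"
  by (auto simp: graph_of_def slot_def edge_slots_def min_def max_def)

lemma fin_graph_graph_of: "fin_graph {1..n} (graph_of n f)"
  by unfold_locales (auto simp: graph_of_def edge_slots_def sym_def irrefl_def)

lemma gnp_eq: "gnp n p = map_pmf (graph_of n) (slot_pmf n p)"
  unfolding gnp_def slot_pmf_def
proof (intro map_pmf_cong)
  show "Pi_pmf {(u, v). 1 \<le> u \<and> u < v \<and> v \<le> n} False (\<lambda>_. bernoulli_pmf p) =
      Pi_pmf (edge_slots n) False (\<lambda>_. bernoulli_pmf p)" by (simp add: edge_slots_def)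
  fix f assume "f \<in> set_pmf (Pi_pmf (edge_slots n) False (\<lambda>_. bernoulli_pmf p))"
  then have "f e \<Longrightarrow> e \<in> edge_slots n" for e
    using set_Pi_pmf_subset[OF finite_edge_slots[of n]] by fastforce
  then show "{(u, v). f (u, v) \<or> f (v, u)} = graph_of n f" by (auto simp: graph_of_def)
qed

text \<open>The set \<open>R\<close> is determined by the edges that avoid \<open>x\<close>, so that the edges at \<open>x\<close> are
  independent of it.\<close>

lemma prob_star_exposure:
  assumes p: "0 \<le> p" "p \<le> 1" and x: "x \<in> {1..n}"
    and R: "\<And>h. R h \<subseteq> {1..n} - {x}" "\<And>f g. R (merge (star n x) f g) = R g"
    and c0: "0 \<le> c"
    and c: "\<And>S. S \<subseteq> star n x \<Longrightarrow> \<phi> (card S) \<Longrightarrow>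
      measure_pmf.prob (Pi_pmf (star n x) False (\<lambda>_. bernoulli_pmf p)) {f. \<psi> (card {e \<in> S. f e})} \<le> c"
  shows "measure_pmf.prob (slot_pmf n p)
    {h. \<phi> (card (R h)) \<and> \<psi> (card {w \<in> R h. (x, w) \<in> graph_of n h})} \<le> c"
proof -
  have sub: "star n x \<subseteq> edge_slots n" by (auto simp: star_def)
  have "measure_pmf.prob (slot_pmf n p) {h. \<phi> (card (R h)) \<and> \<psi> (card {w \<in> R h. (x, w) \<in> graph_of n h})}
    \<le> c * measure_pmf.prob (Pi_pmf (edge_slots n - star n x) False (\<lambda>_. bernoulli_pmf p)) {g. True}"
    unfolding slot_pmf_def
  proof (rule prob_Pi_pmf_split_le[OF finite_edge_slots sub c0])
    fix g
    let ?S = "slot x ` R g"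
    have in_star: "slot x w \<in> star n x" "w \<in> {1..n}" "w \<noteq> x" if "w \<in> R g" for w
    proof -
      show w: "w \<in> {1..n}" "w \<noteq> x" using R(1)[of g] that by blast+
      show "slot x w \<in> star n x" by (rule slot_in_star[OF x w(1) w(2)[symmetric]])
    qed
    then have S: "?S \<subseteq> star n x" by blast
    have card_S: "card ?S = card (R g)" by (rule card_image) (rule inj_on_subset[OF inj_slot], simp)
    have "card {w \<in> R g. (x, w) \<in> graph_of n (merge (star n x) f g)} = card {e \<in> ?S. f e}" for f
    proof -
      have "(x, w) \<in> graph_of n (merge (star n x) f g) \<longleftrightarrow> f (slot x w)" if "w \<in> R g" for w
        using in_star[OF that] by (simp add: in_graph_of_iff[OF x] merge_def)
      then have "{w \<in> R g. (x, w) \<in> graph_of n (merge (star n x) f g)} = {w \<in> R g. f (slot x w)}"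
        by blast
      moreover have "slot x ` {w \<in> R g. f (slot x w)} = {e \<in> ?S. f e}" by blast
      moreover have "inj_on (slot x) A" for A by (rule inj_on_subset[OF inj_slot]) simp
      ultimately show ?thesis by (metis card_image)
    qed
    then show "measure_pmf.prob (Pi_pmf (star n x) False (\<lambda>_. bernoulli_pmf p))
      {f. \<phi> (card (R (merge (star n x) f g))) \<and>
        \<psi> (card {w \<in> R (merge (star n x) f g). (x, w) \<in> graph_of n (merge (star n x) f g)})} \<le> c"
      using c[OF S] c0 unfolding R(2) card_S by (cases "\<phi> (card (R g))") auto
  qed simp
  then show ?thesis by simp
qed

text \<open>The ball around \<open>y\<close> in \<open>G - x\<close>. It does not depend on the
  edges at \<open>x\<close>, so conditionally on it those edges are still independent.\<close>

definition punctured_ball :: "nat \<Rightarrow> nat \<Rightarrow> nat \<Rightarrow> nat \<Rightarrow> (nat \<times> nat \<Rightarrow> bool) \<Rightarrow> nat set" where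
  "punctured_ball n x j y f = {w \<in> {1..n} - {x}. graph_dist (del_vertex x (graph_of n f)) w y \<le> enat j}"

lemma punctured_ball_merge: "punctured_ball n x j y (merge (star n x) f g) = punctured_ball n x j y g"
proof -
  have "del_vertex x (graph_of n (merge (star n x) f g)) = del_vertex x (graph_of n g)"
    by (auto simp: del_vertex_def graph_of_def merge_def star_def)
  then show ?thesis by (simp add: punctured_ball_def)
qed

lemma star_fin: "finite (star n x)"
  using finite_edge_slots by (rule finite_subset[rotated]) (auto simp: star_def)

text \<open>Once the edges avoiding \<open>x\<close> are exposed, the punctured ball is a fixed set
  and the neighbours of \<open>x\<close> in it are a binomial count, to which the upper tail bound
  applies.\<close>

lemma prob_many_back:
  assumes "0 \<le> p" "p \<le> 1" "x \<in> {1..n}" "1 \<le> s" "0 \<le> r"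
  shows "measure_pmf.prob (slot_pmf n p) {h. real (card (punctured_ball n x j y h)) \<le> r \<and>
      t \<le> real (card {w \<in> punctured_ball n x j y h. (x, w) \<in> graph_of n h})}
    \<le> s powr (- t) * exp ((s - 1) * p * r)"
proof (rule prob_star_exposure[where \<phi> = "\<lambda>k. real k \<le> r" and \<psi> = "\<lambda>k. t \<le> real k", OF assms(1-3) _ punctured_ball_merge])
  fix S assume S: "S \<subseteq> star n x" "real (card S) \<le> r"
  have "measure_pmf.prob (Pi_pmf (star n x) False (\<lambda>_. bernoulli_pmf p)) {f. t \<le> real (card {e \<in> S. f e})}
    \<le> s powr (- t) * exp ((s - 1) * p * real (card S))"
    by (rule prob_count_ge[OF star_fin assms(1,2) refl S(1) assms(4)])
  also have "\<dots> \<le> s powr (- t) * exp ((s - 1) * p * r)"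
    using S assms by (intro mult_left_mono) (auto intro!: mult_left_mono)
  finally show "measure_pmf.prob (Pi_pmf (star n x) False (\<lambda>_. bernoulli_pmf p)) {f. t \<le> real (card {e \<in> S. f e})}
    \<le> s powr (- t) * exp ((s - 1) * p * r)" .
qed (auto simp: punctured_ball_def)

lemma prob_not_adjacent:
  assumes "0 \<le> p" "p \<le> 1" "x \<in> {1..n}"
  shows "measure_pmf.prob (slot_pmf n p) {h. r \<le> real (card (punctured_ball n x j y h)) \<and>
      card {w \<in> punctured_ball n x j y h. (x, w) \<in> graph_of n h} = 0}
    \<le> exp (- p * r)"
proof (rule prob_star_exposure[where \<phi> = "\<lambda>k. r \<le> real k" and \<psi> = "\<lambda>k. k = 0", OF assms(1-3) _ punctured_ball_merge])
  fix S assume S: "S \<subseteq> star n x" "r \<le> real (card S)"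
  have "measure_pmf.prob (Pi_pmf (star n x) False (\<lambda>_. bernoulli_pmf p)) {f. card {e \<in> S. f e} = 0}
    \<le> exp (- p * real (card S))"
    by (rule prob_none_le[OF star_fin assms(1,2) refl S(1)])
  also have "\<dots> \<le> exp (- p * r)"
    using S assms by (auto intro!: mult_left_mono)
  finally show "measure_pmf.prob (Pi_pmf (star n x) False (\<lambda>_. bernoulli_pmf p)) {f. card {e \<in> S. f e} = 0}
    \<le> exp (- p * r)" .
qed (auto simp: punctured_ball_def)

section \<open>Degrees, edges inside a set and dominating sets\<close>

lemma star_eq: "x \<in> {1..n} \<Longrightarrow> star n x = slot x ` ({1..n} - {x})"
proof
  assume x: "x \<in> {1..n}"
  show "star n x \<subseteq> slot x ` ({1..n} - {x})"
  proof
    fix e assume e: "e \<in> star n x"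
    then obtain u v where uv: "e = (u, v)" "1 \<le> u" "u < v" "v \<le> n" "u = x \<or> v = x"
      by (auto simp: star_def edge_slots_def)
    show "e \<in> slot x ` ({1..n} - {x})"
    proof (cases "u = x")
      case True
      then show ?thesis using uv by (intro image_eqI[of _ _ v]) (auto simp: slot_def)
    next
      case False
      then show ?thesis using uv by (intro image_eqI[of _ _ u]) (auto simp: slot_def)
    qed
  qed
  show "slot x ` ({1..n} - {x}) \<subseteq> star n x"
    using slot_in_star[OF x] by blast
qed

lemma prob_degree:
  assumes p: "0 \<le> p" "p \<le> 1" and x: "x \<in> {1..n}"
  shows "1 \<le> s \<Longrightarrow> measure_pmf.prob (slot_pmf n p) {h. t \<le> real (card {w. (x, w) \<in> graph_of n h})}
      \<le> s powr (- t) * exp ((s - 1) * p * (real n - 1))"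
    and "0 < s \<Longrightarrow> s \<le> 1 \<Longrightarrow> measure_pmf.prob (slot_pmf n p) {h. real (card {w. (x, w) \<in> graph_of n h}) \<le> t}
      \<le> s powr (- t) * exp ((s - 1) * p * (real n - 1))"
proof -
  let ?S = "star n x"
  have inj: "inj_on (slot x) A" for A by (rule inj_on_subset[OF inj_slot]) simp
  have S: "?S \<subseteq> edge_slots n" by (auto simp: star_def)
  have card_S: "real (card ?S) = real n - 1"
    unfolding star_eq[OF x] using x by (subst card_image[OF inj]) auto
  have deg: "card {w. (x, w) \<in> graph_of n h} = card {e \<in> ?S. h e}" for h
  proof -
    interpret fin_graph "{1..n}" "graph_of n h" by (rule fin_graph_graph_of)
    have "{w. (x, w) \<in> graph_of n h} \<subseteq> {1..n}" using E_V by blast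
    then have "slot x ` {w. (x, w) \<in> graph_of n h} = {e \<in> ?S. h e}"
      unfolding star_eq[OF x] using in_graph_of_iff[OF x, of _ h] by blast
    then show ?thesis using card_image[OF inj] by metis
  qed
  show "measure_pmf.prob (slot_pmf n p) {h. t \<le> real (card {w. (x, w) \<in> graph_of n h})}
      \<le> s powr (- t) * exp ((s - 1) * p * (real n - 1))" if "1 \<le> s"
    unfolding deg card_S[symmetric]
    using finite_edge_slots p slot_pmf_def S that by (rule prob_count_ge)
  show "measure_pmf.prob (slot_pmf n p) {h. real (card {w. (x, w) \<in> graph_of n h}) \<le> t}
      \<le> s powr (- t) * exp ((s - 1) * p * (real n - 1))" if "0 < s" "s \<le> 1"
    unfolding deg card_S[symmetric]
    using finite_edge_slots p slot_pmf_def S that by (rule prob_count_le)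
qed

text \<open>The lower tail bound with \<open>s = 1 / 2\<close> for the slots inside
  \<open>A\<close>, of which there are at least \<open>card A * (card A - 1) / 2\<close>. Every slot
  that is present yields an ordered pair of the relation.\<close>

lemma prob_sparse_set:
  assumes p: "0 \<le> p" "p \<le> 1" and A: "A \<subseteq> {1..n}"
  shows "measure_pmf.prob (slot_pmf n p) {h. real (card (graph_of n h \<inter> A \<times> A)) \<le> t}
    \<le> 2 powr t * exp (- (p * (real (card A) * (real (card A) - 1)) / 4))"
proof -
  let ?F = "edge_slots n \<inter> A \<times> A"
  have finA: "finite A" using A finite_subset by blast
  have finF: "finite ?F" using finite_edge_slots by blast
  have "A \<times> A \<subseteq> ?F \<union> prod.swap ` ?F \<union> (\<lambda>x. (x, x)) ` A"
  proof
    fix z assume "z \<in> A \<times> A"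
    then obtain x y where z: "z = (x, y)" "x \<in> A" "y \<in> A" by auto
    consider "x < y" | "y < x" | "x = y" by linarith
    then show "z \<in> ?F \<union> prod.swap ` ?F \<union> (\<lambda>x. (x, x)) ` A"
    proof cases
      case 2
      then have "(y, x) \<in> ?F" using z A by (auto simp: edge_slots_def)
      then have "prod.swap (y, x) \<in> prod.swap ` ?F" by blast
      then show ?thesis using z by simp
    qed (use z A in \<open>auto simp: edge_slots_def\<close>)
  qed
  then have "card (A \<times> A) \<le> card (?F \<union> prod.swap ` ?F \<union> (\<lambda>x. (x, x)) ` A)"
    using finF finA by (intro card_mono) auto
  also have "\<dots> \<le> card ?F + card (prod.swap ` ?F) + card ((\<lambda>x. (x, x)) ` A)"
    by (meson card_Un_le add_le_mono1 le_trans)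
  also have "\<dots> \<le> card ?F + card ?F + card A"
    using card_image_le[OF finF, of prod.swap] card_image_le[OF finA, of "\<lambda>x. (x, x)"] by linarith
  finally have "real (card A * card A) \<le> real (card ?F + card ?F + card A)"
    by (simp only: card_cartesian_product of_nat_le_iff)
  then have cF: "real (card A) * (real (card A) - 1) / 2 \<le> real (card ?F)"
    by (simp add: algebra_simps)
  have "measure_pmf.prob (slot_pmf n p) {h. real (card (graph_of n h \<inter> A \<times> A)) \<le> t}
    \<le> measure_pmf.prob (slot_pmf n p) {h. real (card {e \<in> ?F. h e}) \<le> t}"
  proof (intro measure_pmf.finite_measure_mono subsetI CollectI)
    fix h assume h: "h \<in> {h. real (card (graph_of n h \<inter> A \<times> A)) \<le> t}"
    have "card {e \<in> ?F. h e} \<le> card (graph_of n h \<inter> A \<times> A)"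
      using finA by (intro card_mono) (auto simp: graph_of_def)
    with h show "real (card {e \<in> ?F. h e}) \<le> t" by simp
  qed simp
  also have "\<dots> \<le> (1 / 2) powr (- t) * exp ((1 / 2 - 1) * p * real (card ?F))"
    by (rule prob_count_le[OF finite_edge_slots p slot_pmf_def]) auto
  also have "\<dots> \<le> (1 / 2) powr (- t) * exp (- (p * (real (card A) * (real (card A) - 1)) / 4))"
    using mult_left_mono[OF cF p(1)] by (intro mult_left_mono) (auto simp: algebra_simps)
  also have "(1 / 2) powr (- t) = (2::real) powr t"
    by (simp add: powr_minus powr_divide)
  finally show ?thesis .
qed

text \<open>Different vertices outside \<open>S\<close> use disjoint slots towards \<open>S\<close>,
  so \<open>prob_all_hit\<close> applies with blocks of at most \<open>card S\<close> slots.\<close>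

lemma prob_dominating:
  assumes p: "0 \<le> p" "p \<le> 1" and S: "S \<subseteq> {1..n}"
  shows "measure_pmf.prob (slot_pmf n p) {h. \<forall>v\<in>{1..n} - S. \<exists>w\<in>S. (v, w) \<in> graph_of n h}
    \<le> exp (- ((1 - p) ^ card S * (real n - real (card S))))"
proof -
  let ?H = "{1..n} - S" and ?F = "\<lambda>v. slot v ` S"
  have finS: "finite S" using S finite_subset by blast
  have "(v, w) \<in> graph_of n h \<longleftrightarrow> h (slot v w)" if "v \<in> ?H" "w \<in> S" for v w h
    using S that by (subst in_graph_of_iff) auto
  then have "(\<forall>v\<in>?H. \<exists>w\<in>S. (v, w) \<in> graph_of n h) \<longleftrightarrow> (\<forall>v\<in>?H. \<exists>e\<in>?F v. h e)" for h
    by auto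
  then have "measure_pmf.prob (slot_pmf n p) {h. \<forall>v\<in>?H. \<exists>w\<in>S. (v, w) \<in> graph_of n h} =
    measure_pmf.prob (slot_pmf n p) {h. \<forall>v\<in>?H. \<exists>e\<in>?F v. h e}" by simp
  also have "\<dots> \<le> (1 - (1 - p) ^ card S) ^ card ?H"
    unfolding slot_pmf_def
  proof (rule prob_all_hit[OF p finite_edge_slots])
    show "?F v \<subseteq> edge_slots n" if "v \<in> ?H" for v using that S by (blast intro: slot_in)
    show "card (?F v) \<le> card S" for v by (rule card_image_le[OF finS])
    show "?F v \<inter> ?F v' = {}" if "v \<in> ?H" "v' \<in> ?H" "v \<noteq> v'" for v v'
      using that by (auto simp: slot_def min_def max_def split: if_splits)
  qed simp
  also have "\<dots> \<le> exp (- ((1 - p) ^ card S)) ^ card ?H"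
  proof (rule power_mono)
    show "1 - (1 - p) ^ card S \<le> exp (- ((1 - p) ^ card S))"
      using exp_ge_add_one_self[of "- ((1 - p) ^ card S)"] by simp
    show "0 \<le> 1 - (1 - p) ^ card S" using p by (simp add: power_le_one)
  qed
  also have "\<dots> = exp (- ((1 - p) ^ card S * real (card ?H)))"
    by (simp add: exp_of_nat_mult[symmetric] mult.commute)
  also have "real (card ?H) = real n - real (card S)"
    using S finS card_mono[OF _ S] by (simp add: card_Diff_subset of_nat_diff)
  finally show ?thesis .
qed

section \<open>Typical random graphs\<close>

lemma prob_Ex_le:
  assumes "finite I" "\<And>x. x \<in> I \<Longrightarrow> measure_pmf.prob P {h. Q x h} \<le> c"
  shows "measure_pmf.prob P {h. \<exists>x\<in>I. Q x h} \<le> real (card I) * c"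
proof -
  have "{h. \<exists>x\<in>I. Q x h} = (\<Union>x\<in>I. {h. Q x h})" by auto
  then have "measure_pmf.prob P {h. \<exists>x\<in>I. Q x h} \<le> (\<Sum>x\<in>I. measure_pmf.prob P {h. Q x h})"
    using measure_pmf.finite_measure_subadditive_finite[OF assms(1), of "\<lambda>x. {h. Q x h}" P] by simp
  also have "\<dots> \<le> real (card I) * c" by (rule sum_bounded_above) (rule assms(2))
  finally show ?thesis .
qed

lemma two_powr_le_exp: "0 \<le> x \<Longrightarrow> 2 powr x \<le> exp (x::real)"
  using ln_2_less_1 by (simp add: powr_def mult_left_le)

lemma two_powr_minus_le_exp:
  assumes "0 \<le> x"
  shows "2 powr (- x) \<le> exp (- (x::real) / 2)"
proof -
  have "(1::real) / 2 \<le> ln 2" using ln2_ge_two_thirds by linarith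
  from mult_left_mono[OF this assms] show ?thesis by (simp add: powr_def)
qed

lemma one_minus_power_ge:
  assumes "0 \<le> p" "p \<le> (1::real) / 2"
  shows "exp (- (2 * p * real s)) \<le> (1 - p) ^ s"
proof -
  have "2 * p\<^sup>2 \<le> p" using mult_left_le[of "2 * p" p] assms by (simp add: power2_eq_square)
  then have "- (2 * p) \<le> ln (1 - p)" using ln_one_minus_pos_lower_bound[of p] assms by auto
  then have "exp (- (2 * p)) \<le> 1 - p" using assms by (simp add: ln_ge_iff)
  then have "exp (- (2 * p)) ^ s \<le> (1 - p) ^ s" by (intro power_mono) auto
  then show ?thesis by (simp add: exp_of_nat_mult[symmetric] mult_ac)
qed

text \<open>The exponent \<open>\<xi>\<close> enters only through the slack \<open>\<delta>\<close>:
  \<open>d ^ i\<close> stays below \<open>n\<close> and \<open>d ^ (i + 1)\<close> above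
  \<open>n\<close> by a factor \<open>n powr \<delta>\<close>.\<close>

locale gnp_regime =
  fixes p d :: "nat \<Rightarrow> real" and i :: nat and \<delta> :: real
  assumes i1: "1 \<le> i" and \<delta>0: "0 < \<delta>" and \<delta>1: "\<delta> < 1 / 2"
    and p01: "\<forall>\<^sub>F n in sequentially. 0 \<le> p n \<and> p n \<le> 1"
    and dp: "\<forall>\<^sub>F n in sequentially. d n = p n * real n"
    and d_upper: "\<forall>\<^sub>F n in sequentially. d n ^ i \<le> real n powr (1 - \<delta>)"
    and d_lower: "\<forall>\<^sub>F n in sequentially. real n powr (1 + \<delta>) \<le> d n ^ (i + 1)"
begin

definition M :: real where "M = 2 * 4 ^ i"
text \<open>Chosen so that \<open>(n powr \<delta>) powr (- K) \<le> n powr (- 3)\<close>, which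
  beats the union bound over \<open>n\<^sup>2\<close> pairs of vertices.\<close>

definition K :: real where "K = max 1 (3 / \<delta>)"
text \<open>\<open>lam\<close> and \<open>alpha\<close> repeat the formulas of
  \<open>spread_graph\<close> as constants fixed before \<open>n\<close> and the graph; the random
  events below refer to them.\<close>

definition lam :: real where "lam = (1 / (16 * K)) ^ i"
definition alpha :: real where "alpha = lam ^ 2 / (4 * M * (1 + 4 * codeg_const M (i - 1)))"
text \<open>Four times the bound \<open>M * d ^ (i + 1) / n\<close> on the expected number of
  neighbours in a ball of radius \<open>i\<close>, so that the tail bound with \<open>s = 2\<close>
  gains from \<open>2 powr (- B)\<close> more than it loses.\<close>

definition B :: "nat \<Rightarrow> real" where "B n = 4 * M * d n ^ (i + 1) / real n"

lemma M_ge: "2 \<le> M" by (simp add: M_def)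
lemma K_ge: "1 \<le> K" by (simp add: K_def)
lemma lam_pos: "0 < lam" using K_ge by (simp add: lam_def)
lemma alpha_pos: "0 < alpha"
proof -
  have "0 \<le> codeg_const M (i - 1)" using M_ge by (intro codeg_const_nonneg) simp
  then show ?thesis using M_ge lam_pos unfolding alpha_def
    by (intro divide_pos_pos mult_pos_pos) auto
qed

definition numeric :: "nat \<Rightarrow> bool" where
  "numeric n \<longleftrightarrow> 2 \<le> n \<and> 0 \<le> p n \<and> p n \<le> 1 \<and> p n * real n = d n \<and>
     d n ^ i \<le> real n powr (1 - \<delta>) \<and> real n powr (1 + \<delta>) \<le> d n ^ (i + 1) \<and>
     real n powr (2 * \<delta>) \<le> d n \<and> 1 \<le> d n \<and> d n \<le> real n powr (1 - \<delta>) \<and>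
     p n \<le> real n powr (- \<delta>) \<and> 16 * B n \<le> d n \<and> real n powr \<delta> \<le> B n"

lemma numericD:
  assumes "numeric n"
  shows "2 \<le> n" "0 \<le> p n" "p n \<le> 1" "p n * real n = d n" "d n ^ i \<le> real n powr (1 - \<delta>)"
    "real n powr (1 + \<delta>) \<le> d n ^ (i + 1)" "real n powr (2 * \<delta>) \<le> d n" "1 \<le> d n"
    "d n \<le> real n powr (1 - \<delta>)" "p n \<le> real n powr (- \<delta>)" "16 * B n \<le> d n" "real n powr \<delta> \<le> B n"
  using assms by (auto simp: numeric_def)

lemma eventually_numeric: "\<forall>\<^sub>F n in sequentially. numeric n"
proof -
  \<comment> \<open>Since \<open>16 * B = 64 * M * (d ^ i / n) * d\<close>, this limit gives
    \<open>16 * B \<le> d\<close>.\<close>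
  have "((\<lambda>n. 64 * M * real n powr (- \<delta>)) \<longlongrightarrow> 0) sequentially" using \<delta>0 by real_asymp
  then have "\<forall>\<^sub>F n in sequentially. 64 * M * real n powr (- \<delta>) < 1"
    by (rule order_tendstoD) simp
  with p01 dp d_upper d_lower eventually_ge_at_top[of 2] show ?thesis
  proof eventually_elim
    case (elim n)
    have n: "0 < real n" "1 \<le> real n" using elim by auto
    have d0: "0 \<le> d n" using elim by simp
    have "0 < d n ^ (i + 1)" using elim(4) n by (smt (verit) powr_gt_zero)
    then have d0: "0 < d n" using d0 by (cases "d n = 0") auto
    \<comment> \<open>Comparing the lower bound on \<open>d ^ (i + 1)\<close> with the upper bound
      on \<open>d ^ i\<close> shows that \<open>d\<close> itself is at least
      \<open>n powr (2 * \<delta>)\<close>.\<close>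
    have step: "real n powr (1 + \<delta>) \<le> d n * real n powr (1 - \<delta>)"
      using elim(4) mult_left_mono[OF elim(3), of "d n"] d0 by (simp add: order.trans)
    have "real n powr (2 * \<delta>) = real n powr (1 + \<delta>) * real n powr (\<delta> - 1)"
      by (simp flip: powr_add)
    also have "\<dots> \<le> (d n * real n powr (1 - \<delta>)) * real n powr (\<delta> - 1)"
      using step by (intro mult_right_mono) auto
    also have "\<dots> = d n" using n by (simp add: mult.assoc flip: powr_add)
    finally have d1: "real n powr (2 * \<delta>) \<le> d n" .
    have "1 \<le> real n powr (2 * \<delta>)" using n \<delta>0 by (intro ge_one_powr_ge_zero) auto
    with d1 have d2: "1 \<le> d n" by simp
    have "d n ^ 1 \<le> d n ^ i" using d2 i1 by (intro power_increasing) auto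
    then have d3: "d n \<le> real n powr (1 - \<delta>)" using elim(3) by simp
    have "p n = d n / real n" using elim(2) n by simp
    also have "\<dots> \<le> real n powr (1 - \<delta>) / real n" using d3 n by (intro divide_right_mono) auto
    also have "\<dots> = real n powr (- \<delta>)" using n by (simp add: powr_diff powr_minus divide_inverse)
    finally have p: "p n \<le> real n powr (- \<delta>)" .
    have dn: "d n ^ i / real n \<le> real n powr (- \<delta>)"
    proof -
      have "d n ^ i / real n \<le> real n powr (1 - \<delta>) / real n" using elim(3) n by (intro divide_right_mono) auto
      also have "\<dots> = real n powr (- \<delta>)" using n by (simp add: powr_diff powr_minus divide_inverse)
      finally show ?thesis .
    qed
    have "16 * B n = 64 * M * (d n ^ i / real n) * d n" by (simp add: B_def)
    also have "\<dots> \<le> (64 * M * real n powr (- \<delta>)) * d n"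
      using dn M_ge d2 by (intro mult_right_mono mult_left_mono) auto
    also have "\<dots> \<le> 1 * d n" using elim d2 by (intro mult_right_mono) auto
    finally have B1: "16 * B n \<le> d n" by simp
    have "real n powr \<delta> = real n powr (1 + \<delta>) / real n" using n by (simp add: powr_add)
    also have "\<dots> \<le> d n ^ (i + 1) / real n" using elim(4) n by (intro divide_right_mono) auto
    also have "\<dots> \<le> B n" unfolding B_def using M_ge d2 by (intro divide_right_mono) auto
    finally have B2: "real n powr \<delta> \<le> B n" .
    show ?case unfolding numeric_def using elim d1 d2 d3 p B1 B2 by auto
  qed
qed

section \<open>Exceptional events of vanishing probability\<close>

definition null :: "(nat \<Rightarrow> (nat \<times> nat \<Rightarrow> bool) \<Rightarrow> bool) \<Rightarrow> bool" where
  "null Q \<longleftrightarrow> (\<lambda>n. measure_pmf.prob (slot_pmf n (p n)) {h. Q n h}) \<longlonglongrightarrow> 0"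

lemma nullI:
  assumes "\<And>n. numeric n \<Longrightarrow> measure_pmf.prob (slot_pmf n (p n)) {h. Q n h} \<le> f n"
    and "f \<longlonglongrightarrow> 0"
  shows "null Q"
  unfolding null_def
proof (rule tendsto_sandwich[OF _ _ tendsto_const assms(2)])
  show "\<forall>\<^sub>F n in sequentially. measure_pmf.prob (slot_pmf n (p n)) {h. Q n h} \<le> f n"
    using eventually_numeric by eventually_elim (rule assms(1))
qed simp

lemma null_disj:
  assumes "null Q" "null Q'"
  shows "null (\<lambda>n h. Q n h \<or> Q' n h)"
  unfolding null_def
proof (rule tendsto_sandwich[OF _ _ tendsto_const])
  show "(\<lambda>n. measure_pmf.prob (slot_pmf n (p n)) {h. Q n h} + measure_pmf.prob (slot_pmf n (p n)) {h. Q' n h}) \<longlonglongrightarrow> 0"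
    using tendsto_add[OF assms[unfolded null_def]] by simp
  show "\<forall>\<^sub>F n in sequentially. measure_pmf.prob (slot_pmf n (p n)) {h. Q n h \<or> Q' n h} \<le>
      measure_pmf.prob (slot_pmf n (p n)) {h. Q n h} + measure_pmf.prob (slot_pmf n (p n)) {h. Q' n h}"
    unfolding Collect_disj_eq by (intro always_eventually allI measure_Un_le) auto
qed simp

definition irregular :: "nat \<Rightarrow> (nat \<times> nat \<Rightarrow> bool) \<Rightarrow> bool" where
  "irregular n h \<longleftrightarrow> (\<exists>x\<in>{1..n}. 4 * d n \<le> real (card {w. (x, w) \<in> graph_of n h})
      \<or> real (card {w. (x, w) \<in> graph_of n h}) \<le> d n / 8)"

text \<open>Tail bounds with \<open>s = 2\<close> and \<open>s = 1 / 2\<close>. As \<open>d\<close>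
  is at least a positive power of \<open>n\<close>, both failure probabilities beat the union bound
  over the vertices.\<close>

lemma null_irregular: "null irregular"
proof (rule nullI)
  fix n assume num: "numeric n"
  note n = numericD[OF num]
  let ?P = "measure_pmf.prob (slot_pmf n (p n))"
  have pn: "p n * (real n - 1) \<le> d n" "d n / 2 \<le> p n * (real n - 1)"
    using n(1,2,4) mult_left_mono[of "real n / 2" "real n - 1" "p n"] by (auto simp: algebra_simps)
  have "?P {h. 4 * d n \<le> real (card {w. (x, w) \<in> graph_of n h})
      \<or> real (card {w. (x, w) \<in> graph_of n h}) \<le> d n / 8} \<le> 2 * exp (- (real n powr (2 * \<delta>) / 8))"
    if x: "x \<in> {1..n}" for x
  proof -
    have "?P {h. 4 * d n \<le> real (card {w. (x, w) \<in> graph_of n h})} \<le>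
        2 powr (- (4 * d n)) * exp ((2 - 1) * p n * (real n - 1))"
      using prob_degree(1)[OF n(2,3) x, of 2] by simp
    also have "\<dots> \<le> exp (- (4 * d n) / 2) * exp (d n)"
      using n(8) pn by (intro mult_mono two_powr_minus_le_exp) auto
    also have "\<dots> \<le> exp (- (real n powr (2 * \<delta>) / 8))" using n(7,8) by (simp add: mult_exp_exp)
    finally have 1: "?P {h. 4 * d n \<le> real (card {w. (x, w) \<in> graph_of n h})} \<le> exp (- (real n powr (2 * \<delta>) / 8))" .
    have "?P {h. real (card {w. (x, w) \<in> graph_of n h}) \<le> d n / 8} \<le>
        (1 / 2) powr (- (d n / 8)) * exp ((1 / 2 - 1) * p n * (real n - 1))"
      by (rule prob_degree(2)[OF n(2,3) x]) auto
    also have "(1 / 2) powr (- (d n / 8)) = 2 powr (d n / 8)"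
      by (simp add: powr_minus powr_divide)
    also have "2 powr (d n / 8) * exp ((1 / 2 - 1) * p n * (real n - 1)) \<le> exp (d n / 8) * exp (- (d n / 4))"
      using n(8) pn by (intro mult_mono two_powr_le_exp) auto
    also have "\<dots> \<le> exp (- (real n powr (2 * \<delta>) / 8))" using n(7) by (simp add: mult_exp_exp)
    finally have 2: "?P {h. real (card {w. (x, w) \<in> graph_of n h}) \<le> d n / 8} \<le> exp (- (real n powr (2 * \<delta>) / 8))" .
    have "?P {h. 4 * d n \<le> real (card {w. (x, w) \<in> graph_of n h}) \<or> real (card {w. (x, w) \<in> graph_of n h}) \<le> d n / 8} \<le>
        ?P {h. 4 * d n \<le> real (card {w. (x, w) \<in> graph_of n h})} + ?P {h. real (card {w. (x, w) \<in> graph_of n h}) \<le> d n / 8}"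
      unfolding Collect_disj_eq by (rule measure_Un_le) auto
    with 1 2 show ?thesis by linarith
  qed
  from prob_Ex_le[OF _ this, of "{1..n}"]
  show "?P {h. irregular n h} \<le> real n * (2 * exp (- (real n powr (2 * \<delta>) / 8)))"
    by (simp add: irregular_def)
next
  show "(\<lambda>n. real n * (2 * exp (- (real n powr (2 * \<delta>) / 8)))) \<longlonglongrightarrow> 0"
    using \<delta>0 by real_asymp
qed

definition many_back :: "nat \<Rightarrow> real \<Rightarrow> real \<Rightarrow> nat \<Rightarrow> (nat \<times> nat \<Rightarrow> bool) \<Rightarrow> bool" where
  "many_back j r t n h \<longleftrightarrow> (\<exists>x\<in>{1..n}. \<exists>y\<in>{1..n}. real (card (punctured_ball n x j y h)) \<le> r \<and>
      t \<le> real (card {w \<in> punctured_ball n x j y h. (x, w) \<in> graph_of n h}))"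

lemma prob_many_back_le:
  assumes "numeric n" "1 \<le> s" "0 \<le> r"
  shows "measure_pmf.prob (slot_pmf n (p n)) {h. many_back j r t n h} \<le>
    real n * (real n * (s powr (- t) * exp ((s - 1) * p n * r)))"
proof -
  note n = numericD[OF assms(1)]
  have "measure_pmf.prob (slot_pmf n (p n)) {h. \<exists>x\<in>{1..n}. \<exists>y\<in>{1..n}. real (card (punctured_ball n x j y h)) \<le> r \<and>
      t \<le> real (card {w \<in> punctured_ball n x j y h. (x, w) \<in> graph_of n h})} \<le>
      real (card {1..n}) * (real (card {1..n}) * (s powr (- t) * exp ((s - 1) * p n * r)))"
    by (intro prob_Ex_le prob_many_back n assms) auto
  then show ?thesis by (simp add: many_back_def)
qed

lemma null_many_back:
  assumes "j \<le> i"
  shows "null (\<lambda>n h. many_back j (M * d n ^ j) (B n) n h)"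
proof (rule nullI)
  fix n assume num: "numeric n"
  note n = numericD[OF num]
  have "p n = d n / real n" using n(1,4) by (simp add: field_simps)
  then have "p n * (M * d n ^ j) = M * d n ^ (j + 1) / real n" by simp
  also have "\<dots> \<le> M * d n ^ (i + 1) / real n"
    using assms n(8) M_ge by (intro divide_right_mono mult_left_mono power_increasing) auto
  also have "\<dots> = B n / 4" by (simp add: B_def)
  finally have pr: "p n * (M * d n ^ j) \<le> B n / 4" .
  have B0: "0 \<le> B n" using n(12) by (smt (verit) powr_ge_zero)
  have r0: "0 \<le> M * d n ^ j" using M_ge n(8) by simp
  have "measure_pmf.prob (slot_pmf n (p n)) {h. many_back j (M * d n ^ j) (B n) n h} \<le>
      real n * (real n * (2 powr (- B n) * exp ((2 - 1) * p n * (M * d n ^ j))))"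
    using r0 by (intro prob_many_back_le num) auto
  also have "\<dots> \<le> real n * (real n * (exp (- B n / 2) * exp (B n / 4)))"
    using pr B0 by (intro mult_left_mono mult_mono two_powr_minus_le_exp) auto
  also have "\<dots> \<le> real n * (real n * exp (- (real n powr \<delta> / 4)))"
    using n(12) by (intro mult_left_mono) (auto simp: mult_exp_exp)
  finally show "measure_pmf.prob (slot_pmf n (p n)) {h. many_back j (M * d n ^ j) (B n) n h} \<le>
      real n * (real n * exp (- (real n powr \<delta> / 4)))" .
next
  show "(\<lambda>n. real n * (real n * exp (- (real n powr \<delta> / 4)))) \<longlonglongrightarrow> 0"
    using \<delta>0 by real_asymp
qed

text \<open>For \<open>j < i\<close> the expected number of neighbours in the ball is at most
  \<open>M * n powr (- \<delta>)\<close>. The large parameter \<open>s = n powr \<delta>\<close>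
  therefore keeps the exponential factor below \<open>exp M\<close>, while a constant threshold
  \<open>K\<close> suffices.\<close>

lemma null_many_back':
  assumes "j < i"
  shows "null (\<lambda>n h. many_back j (M * d n ^ j) K n h)"
proof (rule nullI)
  fix n assume num: "numeric n"
  note n = numericD[OF num]
  have n1: "1 \<le> real n" using n(1) by simp
  have s1: "1 \<le> real n powr \<delta>" using n1 \<delta>0 by (intro ge_one_powr_ge_zero) auto
  have "p n = d n / real n" using n(1,4) by (simp add: field_simps)
  then have "p n * (M * d n ^ j) = M * d n ^ (j + 1) / real n" by simp
  also have "\<dots> \<le> M * d n ^ i / real n"
    using assms n(8) M_ge by (intro divide_right_mono mult_left_mono power_increasing) auto
  also have "\<dots> \<le> M * real n powr (1 - \<delta>) / real n"
    using M_ge n(5) by (intro divide_right_mono mult_left_mono) auto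
  also have "\<dots> = M * real n powr (- \<delta>)" using n1 by (simp add: powr_diff powr_minus divide_inverse)
  finally have pr: "p n * (M * d n ^ j) \<le> M * real n powr (- \<delta>)" .
  have r0: "0 \<le> M * d n ^ j" using M_ge n(8) by simp
  have "(real n powr \<delta> - 1) * p n * (M * d n ^ j) \<le> real n powr \<delta> * (p n * (M * d n ^ j))"
    using mult_nonneg_nonneg[OF n(2) r0] by (auto simp: algebra_simps)
  also have "\<dots> \<le> real n powr \<delta> * (M * real n powr (- \<delta>))"
    by (intro mult_left_mono pr) auto
  also have "\<dots> = M" using n1 by (simp add: powr_minus)
  finally have spr: "(real n powr \<delta> - 1) * p n * (M * d n ^ j) \<le> M" .
  have "3 \<le> \<delta> * K" using \<delta>0 by (simp add: K_def max_def field_simps)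
  then have sK: "(real n powr \<delta>) powr (- K) \<le> real n powr (- 3)"
    using n1 by (simp add: powr_powr powr_mono)
  have "measure_pmf.prob (slot_pmf n (p n)) {h. many_back j (M * d n ^ j) K n h} \<le>
      real n * (real n * ((real n powr \<delta>) powr (- K) * exp ((real n powr \<delta> - 1) * p n * (M * d n ^ j))))"
    by (intro prob_many_back_le num s1 r0)
  also have "\<dots> \<le> real n * (real n * (real n powr (- 3) * exp M))"
    using spr sK by (intro mult_left_mono mult_mono) auto
  finally show "measure_pmf.prob (slot_pmf n (p n)) {h. many_back j (M * d n ^ j) K n h} \<le>
      real n * (real n * (real n powr (- 3) * exp M))" .
next
  show "(\<lambda>n. real n * (real n * (real n powr (- 3) * exp M))) \<longlonglongrightarrow> 0"
    by real_asymp
qed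

definition isolated_from_ball :: "nat \<Rightarrow> (nat \<times> nat \<Rightarrow> bool) \<Rightarrow> bool" where
  "isolated_from_ball n h \<longleftrightarrow> (\<exists>x\<in>{1..n}. \<exists>y\<in>{1..n}. lam * d n ^ i \<le> real (card (punctured_ball n x i y h)) \<and>
      card {w \<in> punctured_ball n x i y h. (x, w) \<in> graph_of n h} = 0)"

text \<open>The expected number of edges from \<open>x\<close> to so large a ball is at least
  \<open>lam * n powr \<delta>\<close>, which makes their absence exponentially unlikely.\<close>

lemma null_isolated_from_ball: "null isolated_from_ball"
proof (rule nullI)
  fix n assume num: "numeric n"
  note n = numericD[OF num]
  have "p n = d n / real n" using n(1,4) by (simp add: field_simps)
  then have "p n * (lam * d n ^ i) = lam * (d n ^ (i + 1) / real n)" by simp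
  moreover have "real n powr \<delta> \<le> d n ^ (i + 1) / real n"
    using n(1,6) by (simp add: powr_add field_simps)
  ultimately have pr: "lam * real n powr \<delta> \<le> p n * (lam * d n ^ i)"
    using lam_pos by (simp only: mult_le_cancel_left_pos)
  have "measure_pmf.prob (slot_pmf n (p n)) {h. \<exists>x\<in>{1..n}. \<exists>y\<in>{1..n}. lam * d n ^ i \<le> real (card (punctured_ball n x i y h)) \<and>
      card {w \<in> punctured_ball n x i y h. (x, w) \<in> graph_of n h} = 0} \<le>
      real (card {1..n}) * (real (card {1..n}) * exp (- p n * (lam * d n ^ i)))"
    by (intro prob_Ex_le prob_not_adjacent n) auto
  also have "\<dots> \<le> real n * (real n * exp (- (lam * real n powr \<delta>)))"
    using pr by (auto intro!: mult_left_mono)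
  finally show "measure_pmf.prob (slot_pmf n (p n)) {h. isolated_from_ball n h} \<le>
      real n * (real n * exp (- (lam * real n powr \<delta>)))" by (simp add: isolated_from_ball_def)
next
  show "(\<lambda>n. real n * (real n * exp (- (lam * real n powr \<delta>)))) \<longlonglongrightarrow> 0"
    using \<delta>0 lam_pos by real_asymp
qed

definition sparse_set :: "nat \<Rightarrow> (nat \<times> nat \<Rightarrow> bool) \<Rightarrow> bool" where
  "sparse_set n h \<longleftrightarrow> (\<exists>A\<in>{A. A \<subseteq> {1..n} \<and> alpha * real n \<le> real (card A)}.
      real (card (graph_of n h \<inter> A \<times> A)) \<le> 4 * B n * real n)"

text \<open>A set of \<open>alpha * n\<close> vertices is expected to span order
  \<open>n * d\<close> edges, far more than \<open>B * n\<close>. The failure probability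
  \<open>exp (- \<Omega>(n * d))\<close> also beats the at most \<open>2 ^ n\<close> choices of the
  set.\<close>

lemma null_sparse_set: "null sparse_set"
proof (rule nullI)
  fix n assume num: "numeric n"
  note n = numericD[OF num]
  let ?\<A> = "{A. A \<subseteq> {1..n} \<and> alpha * real n \<le> real (card A)}"
  have B: "B n \<le> 4 * M * d n * real n powr (- \<delta>)"
  proof -
    have "B n = 4 * M * d n * (d n ^ i / real n)" by (simp add: B_def)
    also have "\<dots> \<le> 4 * M * d n * (real n powr (1 - \<delta>) / real n)"
      using n(1,5,8) M_ge by (intro mult_left_mono divide_right_mono) auto
    also have "real n powr (1 - \<delta>) / real n = real n powr (- \<delta>)"
      using n(1) by (simp add: powr_diff powr_minus divide_inverse)
    finally show ?thesis .
  qed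
  have B0: "0 \<le> B n" using n(12) by (smt (verit) powr_ge_zero)
  define c where "c = real n * d n * (16 * M * real n powr (- \<delta>) - alpha * (alpha - 1 / real n) / 4)"
  have "measure_pmf.prob (slot_pmf n (p n)) {h. real (card (graph_of n h \<inter> A \<times> A)) \<le> 4 * B n * real n} \<le> exp c"
    if A: "A \<in> ?\<A>" for A
  proof -
    have a: "alpha * real n \<le> real (card A)" using A by simp
    moreover have "0 < alpha * real n" using alpha_pos n(1) by simp
    ultimately have "0 < card A" by linarith
    then have a1: "1 \<le> real (card A)" by simp
    have "d n * (alpha * (alpha * real n - 1)) = p n * (alpha * real n * (alpha * real n - 1))"
      by (simp only: n(4)[symmetric] mult_ac)
    also have "\<dots> \<le> p n * (real (card A) * (real (card A) - 1))"
    proof -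
      have "alpha * real n * (alpha * real n - 1) \<le> alpha * real n * (real (card A) - 1)"
        using a alpha_pos by (intro mult_left_mono) auto
      also have "\<dots> \<le> real (card A) * (real (card A) - 1)"
        using a a1 by (intro mult_right_mono) auto
      finally show ?thesis using n(2) by (intro mult_left_mono) auto
    qed
    finally have e: "d n * (alpha * (alpha * real n - 1)) \<le> p n * (real (card A) * (real (card A) - 1))" .
    have "measure_pmf.prob (slot_pmf n (p n)) {h. real (card (graph_of n h \<inter> A \<times> A)) \<le> 4 * B n * real n} \<le>
        2 powr (4 * B n * real n) * exp (- (p n * (real (card A) * (real (card A) - 1)) / 4))"
      using A by (intro prob_sparse_set n) auto
    also have "\<dots> \<le> exp (4 * B n * real n) * exp (- (d n * (alpha * (alpha * real n - 1)) / 4))"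
      using e B0 by (intro mult_mono two_powr_le_exp) auto
    also have "\<dots> = exp (4 * real n * B n - d n * (alpha * (alpha * real n - 1)) / 4)"
      by (simp add: mult_exp_exp algebra_simps)
    also have "\<dots> \<le> exp (4 * real n * (4 * M * d n * real n powr (- \<delta>)) - d n * (alpha * (alpha * real n - 1)) / 4)"
      using mult_left_mono[OF B, of "4 * real n"] by simp
    also have "4 * real n * (4 * M * d n * real n powr (- \<delta>)) - d n * (alpha * (alpha * real n - 1)) / 4 = c"
      using n(1) by (simp add: c_def field_simps)
    finally show ?thesis .
  qed
  from prob_Ex_le[OF _ this, of ?\<A>]
  have "measure_pmf.prob (slot_pmf n (p n)) {h. sparse_set n h} \<le> real (card ?\<A>) * exp c"
    by (simp add: sparse_set_def)
  also have "\<dots> \<le> exp (real n) * exp c"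
  proof (intro mult_right_mono)
    have "card ?\<A> \<le> card (Pow {1..n})" by (intro card_mono) auto
    then have "real (card ?\<A>) \<le> 2 ^ n" by (simp add: card_Pow)
    also have "\<dots> \<le> exp (real n)"
      using two_powr_le_exp[of "real n"] by (simp add: powr_realpow)
    finally show "real (card ?\<A>) \<le> exp (real n)" .
  qed simp
  also have "\<dots> = exp (real n + c)" by (simp add: exp_add)
  also have "\<dots> \<le> exp (real n + real n * (d n * (16 * M * real n powr (- \<delta>) - alpha * (alpha - 1 / real n) / 4)))"
    by (simp add: c_def mult.assoc)
  finally show "measure_pmf.prob (slot_pmf n (p n)) {h. sparse_set n h} \<le>
    exp (real n * (1 + d n * (16 * M * real n powr (- \<delta>) - alpha * (alpha - 1 / real n) / 4)))"
    by (simp add: algebra_simps)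
next
  let ?e = "\<lambda>n. 16 * M * real n powr (- \<delta>) - alpha * (alpha - 1 / real n) / 4"
  let ?f = "\<lambda>n. exp (real n * (1 + d n * ?e n))"
  \<comment> \<open>The bracket \<open>?e\<close> is eventually negative and bounded away from 0, so
    \<open>d n\<close> may be replaced by its lower bound
    \<open>n powr (2 * \<delta>)\<close>.\<close>
  have "?e \<longlonglongrightarrow> - (alpha * alpha / 4)" using \<delta>0 by real_asymp
  moreover have "- (alpha * alpha / 4) < - (alpha * alpha / 8)" using alpha_pos by simp
  ultimately have ev: "\<forall>\<^sub>F n in sequentially. ?e n < - (alpha * alpha / 8)" by (rule order_tendstoD)
  show "?f \<longlonglongrightarrow> 0"
  proof (rule tendsto_sandwich[OF _ _ tendsto_const])
    show "\<forall>\<^sub>F n in sequentially. ?f n \<le> exp (real n * (1 - real n powr (2 * \<delta>) * (alpha * alpha / 8)))"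
      using ev eventually_numeric
    proof eventually_elim
      case (elim n)
      have "d n * ?e n \<le> d n * (- (alpha * alpha / 8))"
        using elim numericD(8)[OF elim(2)] by (intro mult_left_mono) auto
      also have "\<dots> \<le> real n powr (2 * \<delta>) * (- (alpha * alpha / 8))"
        using numericD(7)[OF elim(2)] alpha_pos by (intro mult_right_mono_neg) auto
      finally show ?case by (auto intro!: mult_left_mono)
    qed
    show "(\<lambda>n. exp (real n * (1 - real n powr (2 * \<delta>) * (alpha * alpha / 8)))) \<longlonglongrightarrow> 0"
      using \<delta>0 alpha_pos by real_asymp
  qed simp
qed

definition dom_bound :: "nat \<Rightarrow> nat" where
  "dom_bound n = nat \<lfloor>\<delta> / 2 * (real n * ln (real n) / d n)\<rfloor>"

definition dominated :: "nat \<Rightarrow> (nat \<times> nat \<Rightarrow> bool) \<Rightarrow> bool" where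
  "dominated n h \<longleftrightarrow> (\<exists>S\<in>{S. S \<subseteq> {1..n} \<and> card S = dom_bound n}.
      \<forall>v\<in>{1..n} - S. \<exists>w\<in>S. (v, w) \<in> graph_of n h)"

text \<open>A set of size \<open>dom_bound n\<close> misses a given outside vertex with probability
  at least \<open>n powr (- \<delta>)\<close>, so it dominates with probability about
  \<open>exp (- (n powr (1 - \<delta>)))\<close> at most. There are only
  \<open>exp (O(n powr (1 - 2 * \<delta>) * (ln n)\<^sup>2))\<close> such sets.\<close>

lemma null_dominated: "null dominated"
proof -
  let ?f = "\<lambda>n. exp (\<delta> / 2 * real n powr (1 - 2 * \<delta>) * ln (real n) ^ 2
    - real n powr (- \<delta>) * (real n - \<delta> / 2 * real n powr (1 - 2 * \<delta>) * ln (real n)))"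
  have "((\<lambda>n. real n powr (- \<delta>)) \<longlongrightarrow> 0) sequentially" using \<delta>0 by real_asymp
  then have ev: "\<forall>\<^sub>F n in sequentially. real n powr (- \<delta>) < 1 / 2" by (rule order_tendstoD) simp
  have ev': "\<forall>\<^sub>F n in sequentially. 0 \<le> real n - \<delta> / 2 * real n powr (1 - 2 * \<delta>) * ln (real n)"
    using \<delta>0 by real_asymp
  have lim: "?f \<longlonglongrightarrow> 0" using \<delta>0 \<delta>1 by real_asymp
  show ?thesis unfolding null_def
  proof (rule tendsto_sandwich[OF _ _ tendsto_const lim])
    show "\<forall>\<^sub>F n in sequentially. measure_pmf.prob (slot_pmf n (p n)) {h. dominated n h} \<le> ?f n"
      using ev ev' eventually_numeric
    proof eventually_elim
      case (elim n)
      note n = numericD[OF elim(3)]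
      let ?s = "dom_bound n" and ?\<S> = "{S. S \<subseteq> {1..n} \<and> card S = dom_bound n}"
      have n1: "1 \<le> real n" using n(1) by simp
      have ln0: "0 \<le> ln (real n)" using n1 by simp
      have "0 \<le> \<delta> / 2 * (real n * ln (real n) / d n)" using \<delta>0 n(8) ln0 by simp
      then have s: "real ?s \<le> \<delta> / 2 * (real n * ln (real n) / d n)"
        unfolding dom_bound_def by (simp add: of_nat_floor)
      also have "\<dots> \<le> \<delta> / 2 * (real n * ln (real n) / real n powr (2 * \<delta>))"
        using n(7,8) \<delta>0 ln0 n1 by (intro mult_left_mono divide_left_mono) auto
      also have "\<dots> = \<delta> / 2 * real n powr (1 - 2 * \<delta>) * ln (real n)"
        using n1 by (simp add: powr_diff)
      finally have s': "real ?s \<le> \<delta> / 2 * real n powr (1 - 2 * \<delta>) * ln (real n)" .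
      have "2 * p n * real ?s \<le> 2 * p n * (\<delta> / 2 * (real n * ln (real n) / d n))"
        using s n(2) by (intro mult_left_mono) auto
      also have "\<dots> = \<delta> * ln (real n)" using n(4,8) by (auto simp: field_simps)
      finally have "exp (- (\<delta> * ln (real n))) \<le> exp (- (2 * p n * real ?s))" by simp
      also have "\<dots> \<le> (1 - p n) ^ ?s"
        using n(2,10) elim(1) by (intro one_minus_power_ge) auto
      also have "exp (- (\<delta> * ln (real n))) = real n powr (- \<delta>)" using n1 by (simp add: powr_def)
      finally have q: "real n powr (- \<delta>) \<le> (1 - p n) ^ ?s" .
      let ?c = "exp (- (real n powr (- \<delta>) * (real n - \<delta> / 2 * real n powr (1 - 2 * \<delta>) * ln (real n))))"
      have "measure_pmf.prob (slot_pmf n (p n)) {h. \<forall>v\<in>{1..n} - S. \<exists>w\<in>S. (v, w) \<in> graph_of n h} \<le> ?c"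
        if S: "S \<in> ?\<S>" for S
      proof -
        have "measure_pmf.prob (slot_pmf n (p n)) {h. \<forall>v\<in>{1..n} - S. \<exists>w\<in>S. (v, w) \<in> graph_of n h}
            \<le> exp (- ((1 - p n) ^ card S * (real n - real (card S))))"
          using S by (intro prob_dominating n) auto
        also have "\<dots> \<le> ?c"
          using S q s' elim(2) n(3) by (auto intro!: mult_mono)
        finally show ?thesis .
      qed
      from prob_Ex_le[OF _ this, of ?\<S>]
      have "measure_pmf.prob (slot_pmf n (p n)) {h. dominated n h} \<le> real (card ?\<S>) * ?c"
        by (simp add: dominated_def)
      also have "\<dots> \<le> exp (\<delta> / 2 * real n powr (1 - 2 * \<delta>) * ln (real n) ^ 2) * ?c"
      proof (intro mult_right_mono)
        have "real (card ?\<S>) = real (n choose ?s)" using n_subsets[of "{1..n}" ?s] by simp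
        also have "\<dots> \<le> real n ^ ?s"
          using binomial_le_pow[of ?s n] by (cases "?s \<le> n") (auto simp: binomial_eq_0 simp flip: of_nat_power)
        also have "\<dots> = exp (real ?s * ln (real n))"
          using n1 by (simp add: exp_of_nat_mult)
        also have "\<dots> \<le> exp ((\<delta> / 2 * real n powr (1 - 2 * \<delta>) * ln (real n)) * ln (real n))"
          using mult_right_mono[OF s' ln0] by simp
        finally show "real (card ?\<S>) \<le> exp (\<delta> / 2 * real n powr (1 - 2 * \<delta>) * ln (real n) ^ 2)"
          by (simp add: power2_eq_square mult.assoc)
      qed simp
      also have "\<dots> = ?f n" by (simp add: mult_exp_exp)
      finally show ?case .
    qed
  qed simp
qed


lemma null_Ex:
  assumes "finite I" "\<And>j. j \<in> I \<Longrightarrow> null (Q j)"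
  shows "null (\<lambda>n h. \<exists>j\<in>I. Q j n h)"
  using assms
proof (induction I rule: finite_induct)
  case empty
  then show ?case by (simp add: null_def)
next
  case (insert j I)
  then have "null (\<lambda>n h. Q j n h \<or> (\<exists>j\<in>I. Q j n h))" by (intro null_disj) auto
  then show ?case by simp
qed

section \<open>Structure of a graph outside the exceptional events\<close>

definition bad :: "nat \<Rightarrow> (nat \<times> nat \<Rightarrow> bool) \<Rightarrow> bool" where
  "bad n h \<longleftrightarrow> irregular n h \<or> (\<exists>j\<in>{..i}. many_back j (M * d n ^ j) (B n) n h) \<or>
     (\<exists>j\<in>{..<i}. many_back j (M * d n ^ j) K n h) \<or> isolated_from_ball n h \<or> sparse_set n h \<or> dominated n h"

lemma null_bad: "null bad"
  unfolding bad_def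
  by (intro null_disj null_Ex null_irregular null_many_back null_many_back' null_isolated_from_ball
      null_sparse_set null_dominated) auto

text \<open>The events speak of balls in \<open>G - x\<close>, the locale of distances in
  \<open>G\<close>. The claim \<open>few\<close> translates: if \<open>x\<close> is not closer than
  \<open>j\<close> to \<open>y\<close>, geodesics to \<open>y\<close> avoid \<open>x\<close>, so
  neighbours of \<open>x\<close> near \<open>y\<close> lie in the punctured ball. That ball is
  contained in the ball of \<open>G\<close>, whose size the degrees bound.\<close>

lemma spread_graph_graph_of:
  assumes num: "numeric n" and good: "\<not> bad n h"
  shows "spread_graph {1..n} (graph_of n h) i (d n) (B n) K M"
proof -
  note n = numericD[OF num]
  interpret fin_graph "{1..n}" "graph_of n h" by (rule fin_graph_graph_of)
  have B0: "0 \<le> B n" using n(12) by (smt (verit) powr_ge_zero)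
  have deg: "real (card {w. (x, w) \<in> graph_of n h}) < 4 * d n" "d n / 8 < real (card {w. (x, w) \<in> graph_of n h})"
    if "x \<in> {1..n}" for x
    using good that unfolding bad_def irregular_def by (meson not_le)+
  have few: "real (card {w. (x, w) \<in> graph_of n h \<and> D w y \<le> enat j}) \<le> t"
    if xy: "x \<in> {1..n}" "y \<in> {1..n}" and j: "j \<le> i" and far: "\<not> D x y < enat j"
      and t: "0 \<le> t" "\<not> many_back j (M * d n ^ j) t n h" for x y j t
  proof (cases "x = y")
    case True
    have "j = 0"
    proof (rule ccontr)
      assume "j \<noteq> 0"
      moreover have "D x x = 0" using graph_dist_eq_0_iff[of "graph_of n h" x x] by (simp add: zero_enat_def)
      ultimately show False using far True by (simp add: zero_enat_def)
    qed
    then have "{w. (x, w) \<in> graph_of n h \<and> D w y \<le> enat j} = {}"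
      using irrE True unfolding \<open>j = 0\<close> graph_dist_le_0_iff irrefl_def by blast
    then show ?thesis using t(1) by (simp only: card.empty of_nat_0)
  next
    case False
    let ?R = "punctured_ball n x j y h"
    have "{w. (x, w) \<in> graph_of n h \<and> D w y \<le> enat j} \<subseteq> {w \<in> ?R. (x, w) \<in> graph_of n h}"
    proof
      fix w assume w: "w \<in> {w. (x, w) \<in> graph_of n h \<and> D w y \<le> enat j}"
      then have "w \<noteq> x" "w \<in> {1..n}" using irrE E_V by (auto simp: irrefl_def)
      then show "w \<in> {w \<in> ?R. (x, w) \<in> graph_of n h}"
        using w D_del_vertex[OF far, of w] by (simp add: punctured_ball_def)
    qed
    then have "card {w. (x, w) \<in> graph_of n h \<and> D w y \<le> enat j} \<le> card {w \<in> ?R. (x, w) \<in> graph_of n h}"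
      by (intro card_mono) (auto intro: finite_subset[OF _ finite_nbr[of x]])
    moreover have "real (card {w \<in> ?R. (x, w) \<in> graph_of n h}) < t"
    proof -
      have "?R \<subseteq> {w. D y w \<le> enat j}"
      proof
        fix w assume "w \<in> ?R"
        then have "graph_dist (del_vertex x (graph_of n h)) w y \<le> enat j" by (simp add: punctured_ball_def)
        moreover have "D w y \<le> graph_dist (del_vertex x (graph_of n h)) w y"
          by (rule graph_dist_mono) (auto simp: del_vertex_def)
        ultimately have "D w y \<le> enat j" by (rule order.trans[rotated])
        then show "w \<in> {w. D y w \<le> enat j}" by (simp only: mem_Collect_eq D_sym[of y w])
      qed
      then have "card ?R \<le> card {w. D y w \<le> enat j}" using xy by (intro card_mono) auto
      also have "real \<dots> \<le> M * d n ^ j"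
        unfolding M_def using deg(1) n(8) xy(2) j by (intro card_ball_le) (auto intro: less_imp_le)
      finally have "real (card ?R) \<le> M * d n ^ j" by simp
      then show ?thesis using t(2) xy unfolding many_back_def by (meson not_le)
    qed
    ultimately show ?thesis by linarith
  qed
  show ?thesis
  proof (unfold_locales)
    show "real (card {w. (x, w) \<in> graph_of n h \<and> D w y \<le> enat j}) \<le> B n"
      if "x \<in> {1..n}" "y \<in> {1..n}" "j \<le> i" "\<not> D x y < enat j" for x y j
      using that good B0 by (intro few) (auto simp: bad_def)
    show "real (card {w. (x, w) \<in> graph_of n h \<and> D w y \<le> enat j}) \<le> K"
      if "x \<in> {1..n}" "y \<in> {1..n}" "j < i" "\<not> D x y < enat j" for x y j
      using that good K_ge by (intro few) (auto simp: bad_def)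
    show "d n / 8 \<le> real (card {w. (x, w) \<in> graph_of n h})" if "x \<in> {1..n}" for x
      using deg(2)[OF that] by simp
    show "real (card {w. (x, w) \<in> graph_of n h}) \<le> 4 * d n" if "x \<in> {1..n}" for x
      using deg(1)[OF that] by simp
  qed (use i1 n B0 K_ge in \<open>simp_all add: M_def\<close>)
qed

text \<open>If \<open>x\<close> and \<open>y\<close> were farther apart, the whole
  \<open>i\<close>-sphere around \<open>y\<close> would survive in \<open>G - x\<close>. It has at
  least \<open>lam * d ^ i\<close> vertices, so \<open>x\<close> would be adjacent to the punctured
  ball, which gives a path of length at most \<open>i + 1\<close>.\<close>

lemma diameter_le:
  assumes num: "numeric n" and good: "\<not> bad n h" and xy: "x \<in> {1..n}" "y \<in> {1..n}"
  shows "graph_dist (graph_of n h) x y \<le> enat (Suc i)"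
proof (rule ccontr)
  interpret S: spread_graph "{1..n}" "graph_of n h" i "d n" "B n" K M
    by (rule spread_graph_graph_of[OF num good])
  assume far: "\<not> S.D x y \<le> enat (Suc i)"
  let ?R = "punctured_ball n x i y h"
  have far': "\<not> S.D x y \<le> enat i" using far by (simp add: enat_le_Suc_iff)
  then have far'': "\<not> S.D x y < enat i" by (meson less_imp_le)
  have sub: "{w. S.D w y = enat i} \<subseteq> ?R"
  proof
    fix w assume "w \<in> {w. S.D w y = enat i}"
    then have w: "S.D w y \<le> enat i" by simp
    then have "w \<noteq> x" using far' by auto
    moreover have "w \<in> {1..n}" using S.D_le_in_V[of y w i] w xy S.D_sym by metis
    ultimately show "w \<in> ?R" using S.D_del_vertex[OF far'' _ w] by (simp add: punctured_ball_def)
  qed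
  have "lam * d n ^ i = (d n / (16 * K)) ^ i"
    by (simp add: lam_def power_divide)
  also have "\<dots> \<le> real (card {w. S.D w y = enat i})" using xy by (intro S.sphere_ge) auto
  also have "\<dots> \<le> real (card ?R)"
    using card_mono[OF _ sub] by (simp add: punctured_ball_def)
  finally have big: "lam * d n ^ i \<le> real (card ?R)" .
  have "{w \<in> ?R. (x, w) \<in> graph_of n h} = {}"
  proof (rule ccontr)
    assume "\<not> ?thesis"
    then obtain w where w: "w \<in> ?R" "(x, w) \<in> graph_of n h" by auto
    have "S.D w y \<le> graph_dist (del_vertex x (graph_of n h)) w y"
      by (rule graph_dist_mono) (auto simp: del_vertex_def)
    also have "\<dots> \<le> enat i" using w(1) by (simp add: punctured_ball_def)
    finally show False using w(2) far by (auto simp: graph_dist_le_Suc_iff)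
  qed
  then have "card {w \<in> ?R. (x, w) \<in> graph_of n h} = 0" by simp
  with big xy have "isolated_from_ball n h" unfolding isolated_from_ball_def by blast
  then show False using good by (simp add: bad_def)
qed

section \<open>Bounds on the query numbers\<close>

definition rate :: "nat \<Rightarrow> real" where "rate n = real n * ln (real n) / d n ^ i"

lemma eq_upper:
  assumes num: "numeric n" and good: "\<not> bad n h" and ln1: "1 \<le> ln (real n)"
  shows "\<exists>t. eq {1..n} (graph_of n h) \<le> enat t \<and> real t \<le> (4 / lam + 3) * rate n"
proof -
  note n = numericD[OF num]
  interpret S: spread_graph "{1..n}" "graph_of n h" i "d n" "B n" K M
    by (rule spread_graph_graph_of[OF num good])
  \<comment> \<open>\<open>\<rho>\<close> is the fraction excluded by \<open>heavy_edge\<close>,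
    \<open>m\<close> the size down to which that lemma applies, and \<open>t\<close> is chosen so
    that \<open>(1 - \<rho>) ^ t \<le> 1 / n\<close>.\<close>
  define \<rho> where "\<rho> = lam * d n ^ i / (4 * real n)"
  define m where "m = nat \<lceil>real n / d n ^ i\<rceil>"
  define t where "t = nat \<lceil>ln (real n) / \<rho>\<rceil>"
  have lamS: "S.lam = lam" and alphaS: "S.alpha = alpha"
    by (simp_all add: S.lam_def lam_def S.alpha_def alpha_def)
  have n0: "0 < real n" "1 \<le> real n" using n(1) by auto
  have di: "0 < d n ^ i" using n(8) by simp
  have \<rho>0: "0 < \<rho>" using lam_pos di n0 by (simp add: \<rho>_def)
  have din: "d n ^ i \<le> real n"
  proof -
    have "real n powr (1 - \<delta>) \<le> real n powr 1" using n0 \<delta>0 by (intro powr_mono) auto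
    then show ?thesis using n(5) n0 by simp
  qed
  have "lam \<le> 1" using K_ge unfolding lam_def by (intro power_le_one) auto
  then have "lam * d n ^ i \<le> 1 * real n" using din di lam_pos by (intro mult_mono) auto
  then have \<rho>1: "\<rho> \<le> 1" using n0 by (simp add: \<rho>_def)
  have small: "\<exists>(u, v)\<in>graph_of n h. (\<exists>x\<in>X. S.D u x < S.D v x) \<and> (\<exists>x\<in>X. S.D v x < S.D u x)"
    if X: "X \<subseteq> {1..n}" "2 \<le> card X" for X
  proof -
    obtain x y where xy: "x \<in> X" "y \<in> X" "x \<noteq> y"
    proof -
      have "finite X" using X(1) finite_subset by blast
      moreover have "\<not> card X \<le> Suc 0" using X(2) by simp
      ultimately show ?thesis using that card_le_Suc0_iff_eq by blast
    qed
    have "S.D x y \<le> enat (Suc i)" using diameter_le[OF num good] xy X by blast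
    then have "S.D x y \<noteq> \<infinity>" by (cases "S.D x y") simp_all
    from S.separating_edge[OF xy(3) this] obtain v where
      "(x, v) \<in> graph_of n h" "S.D x x < S.D v x" "S.D v y < S.D x y" .
    with xy show ?thesis by blast
  qed
  have "eq {1..n} (graph_of n h) \<le> enat (t + m)"
    unfolding eq_def
  proof (rule query_number_upper[where \<rho> = \<rho>])
    fix X assume X: "X \<subseteq> {1..n}" "2 \<le> card X" "m \<le> card X"
    then have X0: "X \<noteq> {}" by auto
    have "real n / d n ^ i \<le> real m" unfolding m_def by (rule real_nat_ceiling_ge)
    also have "\<dots> \<le> real (card X)" using X by simp
    finally have Xd: "real (card {1..n}) \<le> real (card X) * d n ^ i" using di by (simp add: pos_divide_le_eq)
    have Bn: "B n * real (card {1..n}) = 4 * M * d n ^ (i + 1)" using n0 by (simp add: B_def)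
    have dense: "4 * B n * real (card {1..n}) < real (card (graph_of n h \<inter> A \<times> A))"
      if "A \<subseteq> {1..n}" "S.alpha * real (card {1..n}) \<le> real (card A)" for A
      using good that by (auto simp: bad_def sparse_set_def alphaS not_le)
    obtain u v where uv: "(u, v) \<in> graph_of n h"
      "S.lam * d n ^ i / (4 * real (card {1..n})) * real (card X) \<le> real (card {x \<in> X. S.D u x < S.D v x})"
      "S.lam * d n ^ i / (4 * real (card {1..n})) * real (card X) \<le> real (card {x \<in> X. S.D v x < S.D u x})"
      by (rule S.heavy_edge[OF Bn dense X(1) X0 Xd]) auto
    have r: "S.lam * d n ^ i / (4 * real (card {1..n})) = \<rho>" by (simp add: \<rho>_def lamS)
    have "0 < \<rho> * real (card X)" using \<rho>0 X by simp
    then have "0 < card {x \<in> X. S.D u x < S.D v x}" "0 < card {x \<in> X. S.D v x < S.D u x}"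
      using uv(2,3) unfolding r by linarith+
    then have "\<exists>x\<in>X. S.D u x < S.D v x" "\<exists>x\<in>X. S.D v x < S.D u x"
      by (auto simp: card_gt_0_iff)
    with uv show "\<exists>(u, v)\<in>graph_of n h. (\<exists>x\<in>X. S.D u x < S.D v x) \<and> (\<exists>x\<in>X. S.D v x < S.D u x) \<and>
      \<rho> * real (card X) \<le> real (card {x \<in> X. S.D u x < S.D v x}) \<and>
      \<rho> * real (card X) \<le> real (card {x \<in> X. S.D v x < S.D u x})"
      unfolding r by blast
  next
    have "(1 - \<rho>) ^ t \<le> exp (- \<rho>) ^ t"
      using \<rho>1 exp_ge_add_one_self[of "- \<rho>"] by (intro power_mono) auto
    also have "\<dots> = exp (- (\<rho> * real t))" by (simp add: exp_of_nat_mult[symmetric] mult.commute)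
    also have "\<dots> \<le> exp (- ln (real n))"
    proof -
      have "ln (real n) / \<rho> \<le> real t" unfolding t_def by (rule real_nat_ceiling_ge)
      then show ?thesis using \<rho>0 by (simp add: pos_divide_le_eq mult.commute)
    qed
    also have "\<dots> = 1 / real n" using n0 by (simp add: exp_minus divide_inverse)
    finally have "real n * (1 - \<rho>) ^ t \<le> 1" using n0 by (simp add: field_simps)
    moreover have "1 \<le> real m"
    proof -
      have "1 \<le> real n / d n ^ i" using din di by simp
      also have "\<dots> \<le> real m" unfolding m_def by (rule real_nat_ceiling_ge)
      finally show ?thesis .
    qed
    ultimately show "real (card {1..n}) * (1 - \<rho>) ^ t \<le> real m" by simp
  qed (use \<rho>0 \<rho>1 small in auto)
  \<comment> \<open>The main part of \<open>t\<close> is \<open>4 / lam * rate n\<close>;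
    \<open>n / d ^ i\<close> and the two roundings cost at most \<open>rate n\<close> each, because
    \<open>1 \<le> n / d ^ i \<le> rate n\<close>.\<close>
  moreover have "real (t + m) \<le> (4 / lam + 3) * rate n"
  proof -
    have nd: "1 \<le> real n / d n ^ i" using din di by simp
    have rate: "real n / d n ^ i \<le> rate n"
      using mult_left_mono[OF ln1, of "real n / d n ^ i"] nd by (simp add: rate_def)
    have "0 \<le> ln (real n) / \<rho>" using ln1 \<rho>0 by simp
    then have "real t \<le> ln (real n) / \<rho> + 1" unfolding t_def by linarith
    also have "ln (real n) / \<rho> = 4 / lam * rate n"
      using n0 lam_pos di by (simp add: \<rho>_def rate_def)
    finally have "real t \<le> 4 / lam * rate n + 1" .
    moreover have "real m \<le> real n / d n ^ i + 1" unfolding m_def using nd by linarith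
    ultimately show ?thesis using nd rate by (simp add: algebra_simps)
  qed
  ultimately show ?thesis by blast
qed

lemma pq_lower:
  assumes num: "numeric n" and good: "\<not> bad n h"
    and ln1: "1 \<le> ln (real n)" "ln (real n) \<le> real n powr (2 * \<delta>)" "8 * M / \<delta> \<le> real n powr \<delta>"
  shows "\<exists>k. enat k \<le> pq {1..n} (graph_of n h) \<and> \<delta> / (4 * M) * rate n \<le> real k"
proof -
  note n = numericD[OF num]
  interpret S: spread_graph "{1..n}" "graph_of n h" i "d n" "B n" K M
    by (rule spread_graph_graph_of[OF num good])
  let ?s = "dom_bound n"
  \<comment> \<open>As many balls of radius \<open>i - 1\<close> as have total size at most
    \<open>dom_bound n\<close>.\<close>
  define k where "k = nat \<lfloor>real ?s / (M * d n ^ (i - 1))\<rfloor>"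
  have n0: "0 < real n" "1 \<le> real n" using n(1) by auto
  have d0: "0 < d n" using n(8) by simp
  have Md: "0 < M * d n ^ (i - 1)" using M_ge d0 by simp
  have x0: "0 \<le> \<delta> / 2 * (real n * ln (real n) / d n)" using \<delta>0 d0 ln1 by simp
  have s_le: "?s \<le> n"
  proof -
    have "real ?s \<le> \<delta> / 2 * (real n * ln (real n) / d n)"
      unfolding dom_bound_def using x0 by (simp add: of_nat_floor)
    also have "\<dots> \<le> 1 * (real n * 1)"
    proof -
      have "ln (real n) \<le> d n" using ln1(2) n(7) by linarith
      then have "real n * (ln (real n) / d n) \<le> real n * 1" using d0 by (intro mult_left_mono) auto
      then show ?thesis using \<delta>0 \<delta>1 d0 ln1 by (intro mult_mono) auto
    qed
    finally show ?thesis by simp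
  qed
  have kM: "real k * (M * d n ^ (i - 1)) \<le> real ?s"
  proof -
    have "real k \<le> real ?s / (M * d n ^ (i - 1))"
      unfolding k_def using Md by (simp add: of_nat_floor)
    then show ?thesis using Md by (simp add: pos_le_divide_eq)
  qed
  have "enat k \<le> pq {1..n} (graph_of n h)"
    unfolding pq_def
  proof (rule query_number_lower[where i = i])
    show "S.D x y \<le> enat (Suc i)" if "x \<in> {1..n}" "y \<in> {1..n}" for x y
      by (rule diameter_le[OF num good that])
    fix W assume W: "W \<subseteq> {1..n}" "card W \<le> k"
    have finW: "finite W" using W finite_subset by blast
    let ?T = "\<Union>w\<in>W. {x. S.D w x \<le> enat (i - 1)}"
    have TV: "?T \<subseteq> {1..n}" using W S.D_le_in_V by blast
    have "card ?T \<le> (\<Sum>w\<in>W. card {x. S.D w x \<le> enat (i - 1)})" by (rule card_UN_le[OF finW])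
    then have "real (card ?T) \<le> (\<Sum>w\<in>W. real (card {x. S.D w x \<le> enat (i - 1)}))"
      by (simp flip: of_nat_sum)
    also have "\<dots> \<le> real (card W) * (M * d n ^ (i - 1))"
      using W by (intro sum_bounded_above S.ball_le) auto
    also have "\<dots> \<le> real k * (M * d n ^ (i - 1))" using W Md by (intro mult_right_mono) auto
    also note kM
    finally have "card ?T \<le> ?s" by simp
    moreover have "?s \<le> card {1..n}" using s_le by simp
    \<comment> \<open>\<open>dominated\<close> speaks of sets of size exactly
      \<open>dom_bound n\<close>, so the union of the balls is enlarged to that size.\<close>
    ultimately obtain T where T: "?T \<subseteq> T" "T \<subseteq> {1..n}" "card T = ?s"
      using exists_subset_between[OF _ _ TV finite_atLeastAtMost] by blast
    have "\<not> (\<forall>v\<in>{1..n} - T. \<exists>w\<in>T. (v, w) \<in> graph_of n h)"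
      using good T(2,3) unfolding bad_def dominated_def by blast
    then obtain v where v: "v \<in> {1..n}" "v \<notin> T" "\<forall>w\<in>T. (v, w) \<notin> graph_of n h" by blast
    \<comment> \<open>A vertex within distance \<open>i\<close> of \<open>w\<close> is
      \<open>w\<close> itself or has a neighbour in the ball of radius \<open>i - 1\<close>; both
      are impossible for the undominated \<open>v\<close>.\<close>
    have "\<not> S.D w v \<le> enat i" if w: "w \<in> W" for w
    proof
      obtain a where a: "i = Suc a" using i1 by (cases i) auto
      assume "S.D w v \<le> enat i"
      then have "S.D v w \<le> enat (Suc a)" using S.D_sym a by metis
      then consider "v = w" | z where "(v, z) \<in> graph_of n h" "S.D z w \<le> enat a"
        by (auto simp: graph_dist_le_Suc_iff)
      then show False
      proof cases
        case 1
        have "S.D w w \<le> enat a" by (auto simp: graph_dist_le_iff intro!: exI[of _ 0])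
        then have "v \<in> ?T" using w 1 a by auto
        then show False using T v by blast
      next
        case 2
        then have "z \<in> ?T" using w a S.D_sym[of z w] by auto
        then show False using T v 2 by blast
      qed
    qed
    then show "\<exists>x\<in>{1..n}. \<forall>w\<in>W. \<not> S.D w x \<le> enat i" using v by blast
  qed simp
  moreover have "\<delta> / (4 * M) * rate n \<le> real k"
  proof -
    have dd: "d n * d n ^ (i - 1) = d n ^ i" using i1 by (cases i) auto
    have "1 \<le> d n ^ (i - 1)" using n(8) by simp
    then have Md1: "1 \<le> M * d n ^ (i - 1)" using M_ge mult_mono[of 1 M 1 "d n ^ (i - 1)"] by simp
    have "\<delta> / (2 * M) * rate n - 1 \<le> (\<delta> / 2 * (real n * ln (real n) / d n) - 1) / (M * d n ^ (i - 1))"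
    proof -
      have "(\<delta> / 2 * (real n * ln (real n) / d n)) / (M * d n ^ (i - 1)) = \<delta> / (2 * M) * rate n"
        using d0 by (simp add: rate_def mult_ac flip: dd)
      moreover have "1 / (M * d n ^ (i - 1)) \<le> 1" using Md1 by simp
      ultimately show ?thesis by (simp add: diff_divide_distrib)
    qed
    also have "\<dots> \<le> real ?s / (M * d n ^ (i - 1))"
    proof (rule divide_right_mono)
      show "\<delta> / 2 * (real n * ln (real n) / d n) - 1 \<le> real ?s"
        unfolding dom_bound_def using x0 by linarith
    qed (use Md in simp)
    also have "\<dots> \<le> real k + 1" unfolding k_def by linarith
    finally have k: "\<delta> / (2 * M) * rate n - 2 \<le> real k" by simp
    \<comment> \<open>The two roundings lose at most 2. As \<open>rate n\<close> is at least
      \<open>8 * M / \<delta>\<close>, half of the main term makes up for it.\<close>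
    have "real n powr \<delta> \<le> rate n"
    proof -
      have "real n powr \<delta> = real n / real n powr (1 - \<delta>)" using n0 by (simp add: powr_diff)
      also have "\<dots> \<le> real n / d n ^ i" using n(5) n0 d0 by (intro divide_left_mono) auto
      also have "\<dots> \<le> rate n" using mult_left_mono[OF ln1(1), of "real n / d n ^ i"] n0 d0 by (simp add: rate_def)
      finally show ?thesis .
    qed
    then have "8 * M / \<delta> \<le> rate n" using ln1(3) by simp
    then have "2 \<le> \<delta> / (4 * M) * rate n" using \<delta>0 M_ge by (simp add: field_simps)
    moreover have "\<delta> / (2 * M) * rate n = \<delta> / (4 * M) * rate n + \<delta> / (4 * M) * rate n"
      by (simp add: field_simps)
    ultimately show ?thesis using k by linarith
  qed
  ultimately show ?thesis by blast
qed

lemma pq_le_eq: "pq {1..n} (graph_of n h) \<le> eq {1..n} (graph_of n h)"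
proof -
  interpret fin_graph "{1..n}" "graph_of n h" by (rule fin_graph_graph_of)
  show ?thesis unfolding pq_def eq_def by (rule query_number_antimono[OF EV])
qed

lemma aas_bounds:
  "aas (\<lambda>n. gnp n (p n)) (\<lambda>n E.
     ereal (\<delta> / (4 * M)) * ereal (rate n) \<le> ereal_of_enat (pq {1..n} E) \<and>
     ereal_of_enat (pq {1..n} E) \<le> ereal_of_enat (eq {1..n} E) \<and>
     ereal_of_enat (eq {1..n} E) \<le> ereal (4 / lam + 3) * ereal (rate n))"
  (is "aas _ ?Q")
  unfolding aas_def
proof (rule tendsto_sandwich[OF _ _ _ tendsto_const])
  show "(\<lambda>n. 1 - measure_pmf.prob (slot_pmf n (p n)) {h. bad n h}) \<longlonglongrightarrow> 1"
    using tendsto_diff[OF tendsto_const null_bad[unfolded null_def], of 1] by simp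
  have "\<forall>\<^sub>F n in sequentially. 1 \<le> ln (real n)"
    "\<forall>\<^sub>F n in sequentially. ln (real n) \<le> real n powr (2 * \<delta>)"
    "\<forall>\<^sub>F n in sequentially. 8 * M / \<delta> \<le> real n powr \<delta>"
    using \<delta>0 M_ge by real_asymp+
  with eventually_numeric
  show "\<forall>\<^sub>F n in sequentially. 1 - measure_pmf.prob (slot_pmf n (p n)) {h. bad n h} \<le>
      measure_pmf.prob (gnp n (p n)) {E. ?Q n E}"
  proof eventually_elim
    case (elim n)
    have "1 - measure_pmf.prob (slot_pmf n (p n)) {h. bad n h} =
        measure_pmf.prob (slot_pmf n (p n)) (UNIV - {h. bad n h})"
      using measure_pmf.prob_compl[of "{h. bad n h}" "slot_pmf n (p n)"] by simp
    also have "\<dots> \<le> measure_pmf.prob (slot_pmf n (p n)) (graph_of n -` {E. ?Q n E})"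
    proof (rule measure_pmf.finite_measure_mono)
      show "UNIV - {h. bad n h} \<subseteq> graph_of n -` {E. ?Q n E}"
      proof
        fix h assume "h \<in> UNIV - {h. bad n h}"
        then have good: "\<not> bad n h" by simp
        obtain t where t: "eq {1..n} (graph_of n h) \<le> enat t" "real t \<le> (4 / lam + 3) * rate n"
          using eq_upper[OF elim(1) good elim(2)] by blast
        obtain k where k: "enat k \<le> pq {1..n} (graph_of n h)" "\<delta> / (4 * M) * rate n \<le> real k"
          using pq_lower[OF elim(1) good elim(2-4)] by blast
        have "ereal_of_enat (eq {1..n} (graph_of n h)) \<le> ereal_of_enat (enat t)"
          using t(1) by (simp only: ereal_of_enat_le_iff)
        also have "\<dots> \<le> ereal (4 / lam + 3) * ereal (rate n)" using t(2) by simp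
        finally have 1: "ereal_of_enat (eq {1..n} (graph_of n h)) \<le> ereal (4 / lam + 3) * ereal (rate n)" .
        have "ereal (\<delta> / (4 * M)) * ereal (rate n) \<le> ereal_of_enat (enat k)" using k(2) by simp
        also have "\<dots> \<le> ereal_of_enat (pq {1..n} (graph_of n h))" using k(1) by (simp only: ereal_of_enat_le_iff)
        finally have 2: "ereal (\<delta> / (4 * M)) * ereal (rate n) \<le> ereal_of_enat (pq {1..n} (graph_of n h))" .
        show "h \<in> graph_of n -` {E. ?Q n E}"
          using 1 2 pq_le_eq[of n h] by (simp only: vimage_eq mem_Collect_eq ereal_of_enat_le_iff)
      qed
    qed simp
    also have "\<dots> = measure_pmf.prob (gnp n (p n)) {E. ?Q n E}"
      by (simp add: gnp_eq)
    finally show ?case .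
  qed
qed simp

end

lemma aas_mono:
  assumes "aas N P" "\<And>n x. P n x \<Longrightarrow> Q n x"
  shows "aas N Q"
  unfolding aas_def
proof (rule tendsto_sandwich[OF _ _ assms(1)[unfolded aas_def] tendsto_const])
  show "\<forall>\<^sub>F n in sequentially. measure_pmf.prob (N n) {x. P n x} \<le> measure_pmf.prob (N n) {x. Q n x}"
    using assms(2) by (intro always_eventually allI measure_pmf.finite_measure_mono) auto
qed simp

theorem corollary1p2:
  fixes p d \<epsilon> :: "nat \<Rightarrow> real" and \<xi> :: real and i :: nat
  assumes "\<And>n. n \<ge> 1 \<Longrightarrow> p n \<in> {0..1}"
    and "\<And>n. n \<ge> 1 \<Longrightarrow> d n = p n * real n"
    and "i \<ge> 1"
    and "\<xi> \<in> {1 / (real i + 1) <..< 1 / real i}"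
    and "\<epsilon> \<longlonglongrightarrow> 0"
    and "\<forall>\<^sub>F n in sequentially. d n = real n powr (\<xi> + \<epsilon> n)"
  shows "aas_bigtheta (\<lambda>n. gnp n (p n))
           (\<lambda>n E. ereal_of_enat (pq {1..n} E)) (\<lambda>n E. ereal_of_enat (eq {1..n} E))
       \<and> aas_bigtheta (\<lambda>n. gnp n (p n))
           (\<lambda>n E. ereal_of_enat (eq {1..n} E)) (\<lambda>n E. ereal (real n * ln (real n) / d n ^ i))
       \<and> aas_bigtheta (\<lambda>n. gnp n (p n))
           (\<lambda>n E. ereal_of_enat (pq {1..n} E)) (\<lambda>n E. ereal (real n * ln (real n) / d n ^ i))"
proof -
  have i0: "0 < real i" using assms(3) by simp
  have "real i * \<xi> < 1" "1 < (real i + 1) * \<xi>"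
    using assms(4) i0 by (auto simp: field_simps)
  \<comment> \<open>As \<open>\<xi>\<close> lies strictly inside its interval, there is room on both
    sides of the exponent 1. The slack chosen here is strictly smaller than that room, so
    \<open>\<epsilon> n\<close> is eventually harmless.\<close>
  moreover have "\<exists>\<delta>. 0 < \<delta> \<and> \<delta> < 1 / 2 \<and> \<delta> < a \<and> \<delta> < b" if "0 < a" "0 < b" for a b :: real
    using that by (intro exI[of _ "min (1 / 4) (min (a / 2) (b / 2))"]) (auto simp: min_def)
  ultimately obtain \<delta> where \<delta>: "0 < \<delta>" "\<delta> < 1 / 2" "\<delta> < 1 - real i * \<xi>" "\<delta> < (real i + 1) * \<xi> - 1"
    by (meson diff_gt_0_iff_gt)
  have "(\<lambda>n. real i * (\<xi> + \<epsilon> n)) \<longlonglongrightarrow> real i * (\<xi> + 0)"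
    by (intro tendsto_intros assms(5))
  then have up: "\<forall>\<^sub>F n in sequentially. real i * (\<xi> + \<epsilon> n) < 1 - \<delta>"
    by (rule order_tendstoD) (use \<delta> in simp)
  have "(\<lambda>n. (real i + 1) * (\<xi> + \<epsilon> n)) \<longlonglongrightarrow> (real i + 1) * (\<xi> + 0)"
    by (intro tendsto_intros assms(5))
  then have lo: "\<forall>\<^sub>F n in sequentially. 1 + \<delta> < (real i + 1) * (\<xi> + \<epsilon> n)"
    by (rule order_tendstoD) (use \<delta> in simp)
  have d_pow: "d n ^ k = real n powr (real k * (\<xi> + \<epsilon> n))"
    if "d n = real n powr (\<xi> + \<epsilon> n)" "1 \<le> n" for n k
    using that by (simp add: powr_powr mult.commute flip: powr_realpow)
  interpret gnp_regime p d i \<delta>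
  proof
    show "\<forall>\<^sub>F n in sequentially. 0 \<le> p n \<and> p n \<le> 1"
      using eventually_ge_at_top[of 1] by eventually_elim (use assms(1) in auto)
    show "\<forall>\<^sub>F n in sequentially. d n = p n * real n"
      using eventually_ge_at_top[of 1] by eventually_elim (use assms(2) in auto)
    show "\<forall>\<^sub>F n in sequentially. d n ^ i \<le> real n powr (1 - \<delta>)"
      using assms(6) up eventually_ge_at_top[of 1]
    proof eventually_elim
      case (elim n)
      then show ?case unfolding d_pow[OF elim(1,3)] by (intro powr_mono) auto
    qed
    show "\<forall>\<^sub>F n in sequentially. real n powr (1 + \<delta>) \<le> d n ^ (i + 1)"
      using assms(6) lo eventually_ge_at_top[of 1]
    proof eventually_elim
      case (elim n)
      then show ?case unfolding d_pow[OF elim(1,3)] by (intro powr_mono) (auto simp: add.commute)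
    qed
  qed (use \<delta> assms(3) in auto)
  define c C where "c = \<delta> / (4 * M)" and "C = 4 / lam + 3"
  have c: "0 < c" and C: "0 < C"
    using \<delta> M_ge lam_pos by (auto simp: c_def C_def intro: add_pos_pos)
  note bounds = aas_bounds[folded c_def C_def, unfolded rate_def]
  \<comment> \<open>The lower bound for one quantity and the upper bound for the other are compared
    through the common rate \<open>Y\<close>.\<close>
  have pq_eq: "ereal (c / C) * x \<le> y" if "ereal c * Y \<le> y" "x \<le> ereal C * Y" for x y Y :: ereal
  proof -
    have "ereal (c / C) * x \<le> ereal (c / C) * (ereal C * Y)"
      using that(2) c C by (intro ereal_mult_left_mono) auto
    also have "\<dots> = ereal c * Y" using C by (simp add: mult.assoc[symmetric])
    also note that(1)
    finally show ?thesis .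
  qed
  show ?thesis
    unfolding aas_bigtheta_def
  proof (intro conjI)
    show "\<exists>c C. 0 < c \<and> 0 < C \<and> aas (\<lambda>n. gnp n (p n)) (\<lambda>n E.
        ereal c * ereal_of_enat (eq {1..n} E) \<le> ereal_of_enat (pq {1..n} E) \<and>
        ereal_of_enat (pq {1..n} E) \<le> ereal C * ereal_of_enat (eq {1..n} E))"
    \<comment> \<open>The upper constant is 1 because every edge query is a pair query.\<close>
    proof (rule exI[of _ "c / C"], rule exI[of _ 1], intro conjI, goal_cases)
      case 3
      show ?case
        by (rule aas_mono[OF bounds]) (use pq_eq in \<open>auto simp flip: one_ereal_def simp del: times_ereal.simps\<close>)
    qed (use c C in auto)
    show "\<exists>c C. 0 < c \<and> 0 < C \<and> aas (\<lambda>n. gnp n (p n)) (\<lambda>n E.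
        ereal c * ereal (real n * ln (real n) / d n ^ i) \<le> ereal_of_enat (eq {1..n} E) \<and>
        ereal_of_enat (eq {1..n} E) \<le> ereal C * ereal (real n * ln (real n) / d n ^ i))"
    proof (rule exI[of _ c], rule exI[of _ C], intro conjI, goal_cases)
      case 3
      show ?case
        by (rule aas_mono[OF bounds]) (blast intro: order.trans)
    qed (use c C in auto)
    show "\<exists>c C. 0 < c \<and> 0 < C \<and> aas (\<lambda>n. gnp n (p n)) (\<lambda>n E.
        ereal c * ereal (real n * ln (real n) / d n ^ i) \<le> ereal_of_enat (pq {1..n} E) \<and>
        ereal_of_enat (pq {1..n} E) \<le> ereal C * ereal (real n * ln (real n) / d n ^ i))"
    proof (rule exI[of _ c], rule exI[of _ C], intro conjI, goal_cases)
      case 3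
      show ?case
        by (rule aas_mono[OF bounds]) (blast intro: order.trans)
    qed (use c C in auto)
  qed
qed

end
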